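(* Let $W$ be a standard one-dimensional Brownian motion, $T>0$, and let $f:\mathbb{R}\to\mathbb{R}$ be bounded with ${\rm osc}_f(\delta)\le C\delta^\alpha$ for some $\alpha\in(0,1]$, $C>0$ and all sufficiently small $\delta>0$. For $\varepsilon>0$ let $Q_\varepsilon(t)=[f(\varepsilon W),\varepsilon W](t)$. Let $(n_\varepsilon)_{\varepsilon>0}$ be positive integers with $n_\varepsilon\nearrow\infty$ as $\varepsilon\to0$, let $\delta_\varepsilon=T/n_\varepsilon$ and $q_\varepsilon=2\sqrt{\delta_\varepsilon|\log\delta_\varepsilon|}$, and let $(\gamma_\varepsilon)_{\varepsilon>0}$ satisfy $\gamma_\varepsilon\to0$ and \[ |\log\delta_\varepsilon|\,\frac{{\rm osc}_f(\varepsilon q_\varepsilon)}{q_\varepsilon\gamma_\varepsilon}\to0,\qquad\varepsilon\to0. \] Then there are positive constants $K_1,K_2,K_3,\varepsilon_0$ such that \[ \mathsf{P}\Big\{\varepsilon^{-1}\sup_{t\le T}|Q_\varepsilon(t)|>\gamma_\varepsilon\Big\}\le K_1\gamma_\varepsilon^{-1}e^{-K_3\gamma_\varepsilon^2/{\rm osc}_f(\varepsilon q_\varepsilon)^2}+K_2\delta_\varepsilon,\qquad\varepsilon\in(0,\varepsilon_0). \]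
   Context: ${\rm osc}_f(\delta)=\sup_{|t-s|<\delta}|f(s)-f(t)|$. The quadratic covariation $[X,Y](t)$ is the limit in probability, as the mesh of partitions of $[0,t]$ tends to $0$, of sums of products of increments of $X$ and $Y$. *)

theory Defs
  imports "HOL-Probability.Probability"
begin

definition osc :: "(real \<Rightarrow> real) \<Rightarrow> real \<Rightarrow> real" where
  "osc f \<delta> = (SUP p \<in> {(s, t). \<bar>t - s\<bar> < \<delta>}. \<bar>f (fst p) - f (snd p)\<bar>)"

definition brownian_motion :: "'a measure \<Rightarrow> (real \<Rightarrow> 'a \<Rightarrow> real) \<Rightarrow> bool" where
  "brownian_motion M W \<longleftrightarrow>
     prob_space M \<and>
     (\<forall>t\<ge>0. W t \<in> borel_measurable M) \<and>
     (\<forall>\<omega>\<in>space M. W 0 \<omega> = 0) \<and>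
     (\<forall>\<omega>\<in>space M. continuous_on {0..} (\<lambda>t. W t \<omega>)) \<and>
     (\<forall>(m::nat) (t::nat \<Rightarrow> real). 0 \<le> t 0 \<longrightarrow> (\<forall>i<m. t i \<le> t (Suc i)) \<longrightarrow>
        prob_space.indep_vars M (\<lambda>_. borel) (\<lambda>i \<omega>. W (t (Suc i)) \<omega> - W (t i) \<omega>) {..<m}) \<and>
     (\<forall>s t. 0 \<le> s \<longrightarrow> s < t \<longrightarrow>
        distributed M lborel (\<lambda>\<omega>. W t \<omega> - W s \<omega>) (normal_density 0 (sqrt (t - s))))"

definition partition_of :: "(nat \<Rightarrow> real) \<Rightarrow> nat \<Rightarrow> real \<Rightarrow> bool" where
  "partition_of p m t \<longleftrightarrow> p 0 = 0 \<and> p m = t \<and> (\<forall>i<m. p i < p (Suc i))"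

definition cov_sum :: "(real \<Rightarrow> 'a \<Rightarrow> real) \<Rightarrow> (real \<Rightarrow> 'a \<Rightarrow> real) \<Rightarrow> (nat \<Rightarrow> real) \<Rightarrow> nat \<Rightarrow> 'a \<Rightarrow> real" where
  "cov_sum X Y p m \<omega> = (\<Sum>i<m. (X (p (Suc i)) \<omega> - X (p i) \<omega>) * (Y (p (Suc i)) \<omega> - Y (p i) \<omega>))"

definition is_qcov :: "'a measure \<Rightarrow> (real \<Rightarrow> 'a \<Rightarrow> real) \<Rightarrow> (real \<Rightarrow> 'a \<Rightarrow> real) \<Rightarrow> real \<Rightarrow> ('a \<Rightarrow> real) \<Rightarrow> bool" where
  "is_qcov M X Y t c \<longleftrightarrow> c \<in> borel_measurable M \<and>
     (\<forall>e>0. \<forall>\<eta>>0. \<exists>d>0. \<forall>m p. partition_of p m t \<and> (\<forall>i<m. p (Suc i) - p i < d) \<longrightarrow>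
        measure M {\<omega> \<in> space M. \<bar>cov_sum X Y p m \<omega> - c \<omega>\<bar> > e} < \<eta>)"

text \<open>exp(-K g^2 / o^2), with the natural convention exp(-infinity) = 0 when o = 0.\<close>
definition gauss_tail :: "real \<Rightarrow> real \<Rightarrow> real \<Rightarrow> real" where
  "gauss_tail K g w = (if w = 0 then 0 else exp (- K * g\<^sup>2 / w\<^sup>2))"

end

theory Submission
  imports Defs "HOL-Real_Asymp.Real_Asymp"
begin

text \<open>
  Cut \<open>[0, T]\<close> into \<open>n\<close> blocks of length \<open>\<delta>\<close>. Outside an event of probability \<open>O(\<delta>)\<close> the Brownian
  path stays within \<open>q\<close> of its value at the left end of each block, and then \<open>f(\<epsilon>W)\<close> may be replaced on
  each block by its increment since that left end, clipped at height \<open>w = osc f (\<epsilon> q)\<close>; clipping makes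
  the integrands bounded on the whole probability space, so that no stopping times are needed.
  On a fine grid the clipped covariation sum of a block is a backward sum minus a forward sum. The
  forward sum is a martingale. Writing an increment of a Gaussian walk as a multiple of the walk's next
  value plus an independent Gaussian turns the backward sum into a reversed martingale plus a drift
  bounded by \<open>w \<Sum> \<bar>U\<^sub>i\<bar> / i\<close>. This gives the exponential moment bound \<open>2 exp (18 \<theta>\<^sup>2 w\<^sup>2 r)\<close> over
  an interval of length \<open>r\<close>, uniformly in the grid. The hypothesis on \<open>\<gamma>\<close> forces
  \<open>n = o(\<gamma>\<^sup>2 / w\<^sup>2)\<close>, which absorbs both the factor \<open>2\<^sup>n\<close> collected over the blocks and a union bound
  over their endpoints. Inside the blocks the supremum is controlled by dyadic chaining.
\<close>

subsection \<open>Gaussian measures\<close>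

text \<open>Since \<open>f\<close> is only Hoelder continuous, \<open>f(\<epsilon>W)\<close> need
  not be a semimartingale and Ito calculus does not apply to it; moreover \<open>Q\<close> is known
  only as a limit in probability. Hence every estimate is made for sums over a finite grid, with a
  bound independent of the mesh, and is then carried to the limit. Subtracting the value of
  \<open>f\<close> at the left end of a block changes no increment inside the block, but it shrinks
  the integrand from the size of \<open>f\<close> to \<open>w\<close>. Martingale sums with
  integrands bounded by \<open>w\<close> have variance of order \<open>w\<^sup>2 T\<close>, the
  source of the Gaussian tail. The factor 2 in \<open>q\<close> makes the bound
  \<open>2 exp (- q\<^sup>2 / (2 \<delta>))\<close> for leaving the tube in one block equal to
  \<open>2 \<delta>\<^sup>2\<close>, so that \<open>n\<close> blocks cost
  \<open>2 T \<delta>\<close>: this is the term with \<open>K2\<close>. The hypothesis on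
  \<open>\<gamma>\<close> is used squared: as
  \<open>q\<^sup>2 = 4 \<delta> \<bar>ln \<delta>\<bar>\<close>, it says that
  \<open>\<bar>ln \<delta>\<bar> n w\<^sup>2 / \<gamma>\<^sup>2\<close> tends to 0.\<close>

definition gauss :: "real \<Rightarrow> real measure" where
  "gauss h = density lborel (\<lambda>x. ennreal (normal_density 0 (sqrt h) x))"

lemma sets_gauss [simp, measurable_cong]: "sets (gauss h) = sets borel"
  by (simp add: gauss_def)

lemma space_gauss [simp]: "space (gauss h) = UNIV"
  by (simp add: gauss_def)

lemma prob_space_gauss: "h > 0 \<Longrightarrow> prob_space (gauss h)"
  unfolding gauss_def by (rule prob_space_normal_density) simp

lemma nn_integral_gauss:
  "F \<in> borel_measurable borel \<Longrightarrow>
    (\<integral>\<^sup>+x. F x \<partial>gauss h) = (\<integral>\<^sup>+x. ennreal (normal_density 0 (sqrt h) x) * F x \<partial>lborel)"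
  unfolding gauss_def by (subst nn_integral_density) simp_all

lemma gauss_mgf:
  assumes h: "h > 0"
  shows "(\<integral>\<^sup>+x. ennreal (exp (a * x)) \<partial>gauss h) = ennreal (exp (a\<^sup>2 * h / 2))"
proof -
  have eq: "normal_density 0 (sqrt h) x * exp (a * x) =
      exp (a\<^sup>2 * h / 2) * normal_density (a * h) (sqrt h) x" for x
  proof -
    have "- x\<^sup>2 / (2 * h) + a * x = a\<^sup>2 * h / 2 + (- (x - a * h)\<^sup>2 / (2 * h))"
      using h by (simp add: field_simps power2_eq_square)
    then show ?thesis
      using h by (simp add: normal_density_def mult_exp_exp)
  qed
  have "(\<integral>\<^sup>+x. ennreal (exp (a * x)) \<partial>gauss h)
      = (\<integral>\<^sup>+x. ennreal (exp (a\<^sup>2 * h / 2)) * ennreal (normal_density (a * h) (sqrt h) x) \<partial>lborel)"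
    by (subst nn_integral_gauss)
       (auto intro!: nn_integral_cong simp: ennreal_mult[symmetric] eq)
  also have "\<dots> = ennreal (exp (a\<^sup>2 * h / 2))"
    using h by (simp add: nn_integral_cmult nn_integral_eq_integral)
  finally show ?thesis .
qed

text \<open>For independent \<open>u \<sim> N(0, l h)\<close> and \<open>y \<sim> N(0, h)\<close>, the sum \<open>w = u + y\<close> and the residual
  \<open>z = y - w / (l + 1)\<close> are uncorrelated, hence independent Gaussians. This yields the time
  reversal of the random walk: \<open>w / (l + 1)\<close> is the drift of the reversed walk.\<close>

lemma gauss_rotation:
  fixes F :: "real \<Rightarrow> real \<Rightarrow> ennreal"
  assumes h: "h > 0" and l: "l > 0"
    and F [measurable]: "case_prod F \<in> borel_measurable (borel \<Otimes>\<^sub>M borel)"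
  shows "(\<integral>\<^sup>+y. (\<integral>\<^sup>+u. F (u + y) (y - (u + y) / (l + 1)) \<partial>gauss (l * h)) \<partial>gauss h)
    = (\<integral>\<^sup>+w. (\<integral>\<^sup>+z. F w z \<partial>gauss (h * l / (l + 1))) \<partial>gauss ((l + 1) * h))"
proof -
  let ?p = "\<lambda>v x. normal_density 0 (sqrt v) x"
  have dens: "?p h (z + w / (l + 1)) * ?p (l * h) (w - (z + w / (l + 1)))
      = ?p ((l + 1) * h) w * ?p (h * l / (l + 1)) z" for w z
  proof -
    have e: "- (z + w / (l + 1))\<^sup>2 / (2 * h) + - (w - (z + w / (l + 1)))\<^sup>2 / (2 * (l * h))
       = - w\<^sup>2 / (2 * ((l + 1) * h)) + - z\<^sup>2 / (2 * (h * l / (l + 1)))"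
    proof -
      define k where "k = l + 1"
      have k: "k > 0" "l = k - 1" using l by (auto simp: k_def)
      show ?thesis
        unfolding k_def[symmetric] using k h l
        by (simp add: divide_simps) (simp add: k(2) algebra_simps power2_eq_square)
    qed
    have s: "1 / sqrt (2 * pi * h) * (1 / sqrt (2 * pi * (l * h)))
        = 1 / sqrt (2 * pi * ((l + 1) * h)) * (1 / sqrt (2 * pi * (h * l / (l + 1))))"
      using h l by (simp add: real_sqrt_mult[symmetric])
    have pp: "1 / sqrt (2 * pi * h) * exp a * (1 / sqrt (2 * pi * (l * h)) * exp b) =
       1 / sqrt (2 * pi * ((l + 1) * h)) * exp c * (1 / sqrt (2 * pi * (h * l / (l + 1))) * exp d)"
      if "a + b = c + d" for a b c d
    proof -
      have "1 / sqrt (2 * pi * h) * exp a * (1 / sqrt (2 * pi * (l * h)) * exp b)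
        = (1 / sqrt (2 * pi * h) * (1 / sqrt (2 * pi * (l * h)))) * exp (a + b)"
        by (simp add: exp_add)
      also have "\<dots> = (1 / sqrt (2 * pi * ((l + 1) * h)) * (1 / sqrt (2 * pi * (h * l / (l + 1))))) * exp (c + d)"
        by (simp only: s that)
      finally show ?thesis by (simp add: exp_add)
    qed
    show ?thesis
      using h l pp[OF e] by (simp add: normal_density_def)
  qed
  \<comment> \<open>The map from \<open>(u, y)\<close> to \<open>(w, z)\<close> has determinant 1.
    It is carried out as two translations: \<open>u\<close> to \<open>w\<close> with
    \<open>y\<close> fixed, and after Fubini \<open>y\<close> to \<open>z\<close> with
    \<open>w\<close> fixed.\<close>
  have shift1: "(\<integral>\<^sup>+u. ennreal (?p (l * h) u) * F (u + y) (y - (u + y) / (l + 1)) \<partial>lborel)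
      = (\<integral>\<^sup>+w. ennreal (?p (l * h) (w - y)) * F w (y - w / (l + 1)) \<partial>lborel)" for y
    by (subst nn_integral_real_affine[where c = 1 and t = "- y"]) (auto simp: algebra_simps)
  have shift2: "(\<integral>\<^sup>+y. ennreal (?p h y) *
         (ennreal (?p (l * h) (w - y)) * F w (y - w / (l + 1))) \<partial>lborel)
      = (\<integral>\<^sup>+z. ennreal (?p h (z + w / (l + 1))) *
         (ennreal (?p (l * h) (w - (z + w / (l + 1)))) * F w z) \<partial>lborel)" for w
    by (subst nn_integral_real_affine[where c = 1 and t = "w / (l + 1)"])
       (auto simp: add.commute)
  have "(\<integral>\<^sup>+y. (\<integral>\<^sup>+u. F (u + y) (y - (u + y) / (l + 1)) \<partial>gauss (l * h)) \<partial>gauss h)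
     = (\<integral>\<^sup>+y. ennreal (?p h y) *
         (\<integral>\<^sup>+u. ennreal (?p (l * h) u) * F (u + y) (y - (u + y) / (l + 1)) \<partial>lborel) \<partial>lborel)"
    by (subst nn_integral_gauss, measurable) (simp add: nn_integral_gauss)
  also have "\<dots> = (\<integral>\<^sup>+y. ennreal (?p h y) *
         (\<integral>\<^sup>+w. ennreal (?p (l * h) (w - y)) * F w (y - w / (l + 1)) \<partial>lborel) \<partial>lborel)"
    by (simp only: shift1)
  also have "\<dots> = (\<integral>\<^sup>+y. (\<integral>\<^sup>+w. ennreal (?p h y) *
         (ennreal (?p (l * h) (w - y)) * F w (y - w / (l + 1))) \<partial>lborel) \<partial>lborel)"
    by (simp add: nn_integral_cmult)
  also have "\<dots> = (\<integral>\<^sup>+w. (\<integral>\<^sup>+y. ennreal (?p h y) *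
         (ennreal (?p (l * h) (w - y)) * F w (y - w / (l + 1))) \<partial>lborel) \<partial>lborel)"
    by (rule lborel_pair.Fubini') measurable
  also have "\<dots> = (\<integral>\<^sup>+w. (\<integral>\<^sup>+z. ennreal (?p h (z + w / (l + 1))) *
         (ennreal (?p (l * h) (w - (z + w / (l + 1)))) * F w z) \<partial>lborel) \<partial>lborel)"
    by (simp only: shift2)
  also have "\<dots> = (\<integral>\<^sup>+w. (\<integral>\<^sup>+z. ennreal (?p ((l + 1) * h) w) *
         (ennreal (?p (h * l / (l + 1)) z) * F w z) \<partial>lborel) \<partial>lborel)"
    by (simp add: mult.assoc[symmetric] ennreal_mult[symmetric] dens)
  also have "\<dots> = (\<integral>\<^sup>+w. ennreal (?p ((l + 1) * h) w) *
         (\<integral>\<^sup>+z. ennreal (?p (h * l / (l + 1)) z) * F w z \<partial>lborel) \<partial>lborel)"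
    by (simp add: nn_integral_cmult)
  also have "\<dots> = (\<integral>\<^sup>+w. (\<integral>\<^sup>+z. F w z \<partial>gauss (h * l / (l + 1))) \<partial>gauss ((l + 1) * h))"
    by (subst nn_integral_gauss, measurable) (simp add: nn_integral_gauss)
  finally show ?thesis .
qed

abbreviation gauss_prod :: "real \<Rightarrow> nat set \<Rightarrow> (nat \<Rightarrow> real) measure" where
  "gauss_prod h I \<equiv> PiM I (\<lambda>_. gauss h)"

lemma product_sigma_finite_gauss: "h > 0 \<Longrightarrow> product_sigma_finite (\<lambda>_::nat. gauss h)"
  by (simp add: product_sigma_finite_def prob_space_gauss prob_space_imp_sigma_finite)

lemma prob_space_gauss_prod: "h > 0 \<Longrightarrow> prob_space (gauss_prod h I)"
  by (simp add: prob_space_PiM prob_space_gauss)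

lemma measurable_gauss_prod_component [measurable (raw)]:
  "i \<in> I \<Longrightarrow> (\<lambda>x. x i) \<in> borel_measurable (gauss_prod h I)"
  using measurable_component_singleton[of i I "\<lambda>_. gauss h"] by simp

lemma measurable_gauss_prod_sum [measurable (raw)]:
  "J \<subseteq> I \<Longrightarrow> (\<lambda>x. sum x J) \<in> borel_measurable (gauss_prod h I)"
  by (rule borel_measurable_sum) (auto intro: measurable_gauss_prod_component)

subsection \<open>Exponential moments of covariation sums\<close>

text \<open>The last increment is split off in both orders of integration. Innermost, it is averaged
  with the past held fixed, as for a martingale; outermost, the shorter walk is integrated first, so
  that an induction hypothesis with a test function of its end point applies.\<close>

lemma gauss_prod_peel:
  assumes h: "h > 0" and F: "F \<in> borel_measurable (gauss_prod h {b..<b + Suc l})"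
  shows "integral\<^sup>N (gauss_prod h {b..<b + Suc l}) F
      = (\<integral>\<^sup>+x. (\<integral>\<^sup>+y. F (x(b + l := y)) \<partial>gauss h) \<partial>gauss_prod h {b..<b + l})" (is ?t1)
    and "integral\<^sup>N (gauss_prod h {b..<b + Suc l}) F
      = (\<integral>\<^sup>+y. (\<integral>\<^sup>+x. F (x(b + l := y)) \<partial>gauss_prod h {b..<b + l}) \<partial>gauss h)" (is ?t2)
proof -
  interpret product_sigma_finite "\<lambda>_::nat. gauss h"
    by (rule product_sigma_finite_gauss[OF h])
  have I: "{b..<b + Suc l} = insert (b + l) {b..<b + l}" by auto
  show ?t1 ?t2
    using F unfolding I
    by (auto intro!: product_nn_integral_insert product_nn_integral_insert_rev)
qed

lemma sum_interval_upd:
  fixes x :: "nat \<Rightarrow> real"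
  shows "i \<le> l \<Longrightarrow> sum (x(b + l := y)) {b..<b + i} = sum x {b..<b + i}"
    and "sum (x(b + l := y)) {b..<b + Suc l} = sum x {b..<b + l} + y"
proof -
  show *: "sum (x(b + l := y)) {b..<b + i} = sum x {b..<b + i}" if "i \<le> l" for i
    using that by (intro sum.cong) auto
  show "sum (x(b + l := y)) {b..<b + Suc l} = sum x {b..<b + l} + y"
    using *[of l] by simp
qed

text \<open>The integrand is evaluated at the left end of each step, so no integrand involves the
  last increment. Integrating that increment first leaves the factor
  \<open>exp ((\<theta> \<phi>)\<^sup>2 h / 2)\<close>, at most
  \<open>exp (\<theta>\<^sup>2 c\<^sup>2 h / 2)\<close>.\<close>

lemma forward_mgf:
  fixes \<phi> :: "real \<Rightarrow> real"
  assumes h: "h > 0" and [measurable]: "\<phi> \<in> borel_measurable borel" and \<phi>: "\<And>u. \<bar>\<phi> u\<bar> \<le> c"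
  shows "(\<integral>\<^sup>+x. ennreal (exp (\<theta> * (\<Sum>i<l. \<phi> (sum x {b..<b + i}) * x (b + i))))
            \<partial>gauss_prod h {b..<b + l}) \<le> ennreal (exp (\<theta>\<^sup>2 * c\<^sup>2 * h * real l / 2))"
proof (induction l)
  case 0
  then show ?case
    using prob_space.emeasure_space_1[OF prob_space_gauss_prod[OF h]] by simp
next
  case (Suc l)
  let ?S = "\<lambda>l x. \<Sum>i<l. \<phi> (sum x {b..<b + i}) * x (b + i)"
  let ?e = "ennreal (exp (\<theta>\<^sup>2 * c\<^sup>2 * h / 2))"
  have m: "(\<lambda>x. \<phi> (sum x {b..<b + i}) * x (b + i)) \<in> borel_measurable (gauss_prod h {b..<b + L})"
    if "i < L" for i L
    using that by (intro borel_measurable_times measurable_compose[OF measurable_gauss_prod_sum]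
        measurable_gauss_prod_component) auto
  have mS: "?S L \<in> borel_measurable (gauss_prod h {b..<b + L})" for L
    by (intro borel_measurable_sum) (simp add: m)
  have upd: "?S l (x(b + l := y)) = ?S l x" for x y
    by (intro sum.cong refl) (simp add: sum_interval_upd)
  have "(\<integral>\<^sup>+x. ennreal (exp (\<theta> * ?S (Suc l) x)) \<partial>gauss_prod h {b..<b + Suc l})
     = (\<integral>\<^sup>+x. (\<integral>\<^sup>+y. ennreal (exp (\<theta> * ?S (Suc l) (x(b + l := y)))) \<partial>gauss h) \<partial>gauss_prod h {b..<b + l})"
    using mS[of "Suc l"] by (intro gauss_prod_peel(1)[OF h]) measurable
  also have "\<dots> = (\<integral>\<^sup>+x. (\<integral>\<^sup>+y. ennreal (exp (\<theta> * ?S l x)) *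
         ennreal (exp ((\<theta> * \<phi> (sum x {b..<b + l})) * y)) \<partial>gauss h) \<partial>gauss_prod h {b..<b + l})"
    by (simp add: upd sum_interval_upd ennreal_mult[symmetric] exp_add[symmetric] algebra_simps)
  also have "\<dots> = (\<integral>\<^sup>+x. ennreal (exp (\<theta> * ?S l x)) *
         ennreal (exp ((\<theta> * \<phi> (sum x {b..<b + l}))\<^sup>2 * h / 2)) \<partial>gauss_prod h {b..<b + l})"
    by (simp add: nn_integral_cmult gauss_mgf[OF h])
  also have "\<dots> \<le> (\<integral>\<^sup>+x. ennreal (exp (\<theta> * ?S l x)) * ?e \<partial>gauss_prod h {b..<b + l})"
  proof (intro nn_integral_mono mult_left_mono ennreal_leI)
    fix x
    have "(\<phi> (sum x {b..<b + l}))\<^sup>2 \<le> c\<^sup>2"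
      using power_mono[OF \<phi>, of "sum x {b..<b + l}" 2] by simp
    then show "exp ((\<theta> * \<phi> (sum x {b..<b + l}))\<^sup>2 * h / 2) \<le> exp (\<theta>\<^sup>2 * c\<^sup>2 * h / 2)"
      using h by (simp add: power_mult_distrib mult_left_mono mult_right_mono)
  qed simp
  also have "\<dots> = (\<integral>\<^sup>+x. ennreal (exp (\<theta> * ?S l x)) \<partial>gauss_prod h {b..<b + l}) * ?e"
    using mS[of l] by (intro nn_integral_multc) measurable
  also have "\<dots> \<le> ennreal (exp (\<theta>\<^sup>2 * c\<^sup>2 * h * real l / 2)) * ?e"
    by (intro mult_right_mono Suc) simp
  also have "\<dots> = ennreal (exp (\<theta>\<^sup>2 * c\<^sup>2 * h * real (Suc l) / 2))"
    by (simp add: ennreal_mult[symmetric] exp_add[symmetric] field_simps)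
  finally show ?case .
qed

text \<open>The test function \<open>g\<close> of the end point makes the induction close: the top
  summand and \<open>g\<close> together form a test function of the previous end point, and after
  \<open>gauss_rotation\<close> the residual increment is independent of the new end point. The case
  \<open>l = 0\<close> is excluded because \<open>gauss 0\<close> has density 0 and is not a
  probability measure.\<close>

lemma backward_mgf:
  fixes \<phi> :: "real \<Rightarrow> real" and g :: "real \<Rightarrow> ennreal"
  assumes h: "h > 0" and [measurable]: "\<phi> \<in> borel_measurable borel" and \<phi>: "\<And>u. \<bar>\<phi> u\<bar> \<le> c"
    and [measurable]: "g \<in> borel_measurable borel" and l: "1 \<le> l"
  shows "(\<integral>\<^sup>+x. ennreal (exp (\<theta> * (\<Sum>i<l. \<phi> (sum x {b..<b + Suc i}) *
              (x (b + i) - sum x {b..<b + Suc i} / real (Suc i))))) * g (sum x {b..<b + l})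
            \<partial>gauss_prod h {b..<b + l})
         \<le> ennreal (exp (\<theta>\<^sup>2 * c\<^sup>2 * h * real l / 2)) * (\<integral>\<^sup>+w. g w \<partial>gauss (real l * h))"
  using l assms(4)
proof (induction l arbitrary: g rule: nat_induct_at_least)
  \<comment> \<open>A walk of one step equals its own end point, so the residual
    \<open>x b - sum x {b..<b + 1} / 1\<close> vanishes and only \<open>g\<close> is left.\<close>
  case base
  interpret product_sigma_finite "\<lambda>_::nat. gauss h"
    by (rule product_sigma_finite_gauss[OF h])
  note base [measurable]
  have "(\<integral>\<^sup>+x. g (x b) \<partial>gauss_prod h {b}) = (\<integral>\<^sup>+w. g w \<partial>gauss h)"
    by (intro product_nn_integral_singleton) measurable
  moreover have "(\<integral>\<^sup>+w. g w \<partial>gauss h) \<le> ennreal (exp (\<theta>\<^sup>2 * c\<^sup>2 * h / 2)) * (\<integral>\<^sup>+w. g w \<partial>gauss h)"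
    using mult_right_mono[of 1 "ennreal (exp (\<theta>\<^sup>2 * c\<^sup>2 * h / 2))" "\<integral>\<^sup>+w. g w \<partial>gauss h"] h
    by simp
  moreover have "{b..<Suc b} = {b}" by auto
  ultimately show ?case by simp
next
  case (Suc l g)
  note Suc.prems [measurable]
  let ?R = "\<lambda>i x. \<phi> (sum x {b..<b + Suc i}) * (x (b + i) - sum x {b..<b + Suc i} / real (Suc i))"
  let ?S = "\<lambda>l x. \<Sum>i<l. ?R i x"
  let ?e = "\<lambda>l. ennreal (exp (\<theta>\<^sup>2 * c\<^sup>2 * h * real l / 2))"
  have m: "?R i \<in> borel_measurable (gauss_prod h {b..<b + L})" if "i < L" for i L
    using that by (intro borel_measurable_times borel_measurable_diff borel_measurable_divide
        measurable_compose[OF measurable_gauss_prod_sum]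
        measurable_gauss_prod_sum measurable_gauss_prod_component) auto
  have mS: "?S L \<in> borel_measurable (gauss_prod h {b..<b + L})" for L
    by (intro borel_measurable_sum) (simp add: m del: sum.op_ivl_Suc)
  have upd: "?S l (x(b + l := y)) = ?S l x" for x y
    by (intro sum.cong refl) (auto simp: sum_interval_upd simp del: sum.op_ivl_Suc)
  \<comment> \<open>For a fixed last increment \<open>y\<close> this is a function of the earlier
    end point \<open>u\<close>; it is the test function passed to the induction hypothesis.\<close>
  define G where "G = (\<lambda>y u. ennreal (exp (\<theta> * (\<phi> (u + y) * (y - (u + y) / (real l + 1))))) * g (u + y))"
  have mG [measurable]: "case_prod G \<in> borel_measurable (borel \<Otimes>\<^sub>M borel)"
    unfolding G_def by measurable
  have eq: "ennreal (exp (\<theta> * ?S (Suc l) (x(b + l := y)))) * g (sum (x(b + l := y)) {b..<b + Suc l})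
      = ennreal (exp (\<theta> * ?S l x)) * G y (sum x {b..<b + l})" for x y
    unfolding G_def sum.lessThan_Suc upd sum_interval_upd(2)
    by (simp add: ennreal_mult[symmetric] exp_add[symmetric] distrib_left mult.assoc[symmetric] add.commute
        del: sum.op_ivl_Suc)
  have l0: "real l > 0" "h * real l / (real l + 1) > 0" using Suc.hyps h by auto
  have "(\<integral>\<^sup>+x. ennreal (exp (\<theta> * ?S (Suc l) x)) * g (sum x {b..<b + Suc l}) \<partial>gauss_prod h {b..<b + Suc l})
     = (\<integral>\<^sup>+y. (\<integral>\<^sup>+x. ennreal (exp (\<theta> * ?S (Suc l) (x(b + l := y)))) *
           g (sum (x(b + l := y)) {b..<b + Suc l}) \<partial>gauss_prod h {b..<b + l}) \<partial>gauss h)"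
    using mS[of "Suc l"] measurable_compose[OF measurable_gauss_prod_sum Suc.prems]
    by (intro gauss_prod_peel(2)[OF h]) measurable
  also have "\<dots> = (\<integral>\<^sup>+y. (\<integral>\<^sup>+x. ennreal (exp (\<theta> * ?S l x)) * G y (sum x {b..<b + l})
       \<partial>gauss_prod h {b..<b + l}) \<partial>gauss h)"
    by (simp only: eq)
  also have "\<dots> \<le> (\<integral>\<^sup>+y. ?e l * (\<integral>\<^sup>+u. G y u \<partial>gauss (real l * h)) \<partial>gauss h)"
    by (intro nn_integral_mono Suc.IH) measurable
  also have "\<dots> = ?e l * (\<integral>\<^sup>+y. (\<integral>\<^sup>+u. G y u \<partial>gauss (real l * h)) \<partial>gauss h)"
    using prob_space_imp_sigma_finite[OF prob_space_gauss[of "real l * h"]] l0 h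
    by (intro nn_integral_cmult sigma_finite_measure.borel_measurable_nn_integral) measurable
  also have "(\<integral>\<^sup>+y. (\<integral>\<^sup>+u. G y u \<partial>gauss (real l * h)) \<partial>gauss h)
     = (\<integral>\<^sup>+w. (\<integral>\<^sup>+z. ennreal (exp (\<theta> * (\<phi> w * z))) * g w \<partial>gauss (h * real l / (real l + 1)))
          \<partial>gauss ((real l + 1) * h))"
    unfolding G_def
    using gauss_rotation[OF h l0(1), where F = "\<lambda>w z. ennreal (exp (\<theta> * (\<phi> w * z))) * g w"] by simp
  also have "\<dots> = (\<integral>\<^sup>+w. ennreal (exp ((\<theta> * \<phi> w)\<^sup>2 * (h * real l / (real l + 1)) / 2)) * g w
          \<partial>gauss ((real l + 1) * h))"
    using gauss_mgf[OF l0(2), where a = "\<theta> * \<phi> w" for w]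
    by (simp add: nn_integral_multc mult.assoc)
  also have "\<dots> \<le> (\<integral>\<^sup>+w. ennreal (exp (\<theta>\<^sup>2 * c\<^sup>2 * h / 2)) * g w \<partial>gauss ((real l + 1) * h))"
  proof (intro nn_integral_mono mult_right_mono ennreal_leI)
    fix w
    have "(\<phi> w)\<^sup>2 \<le> c\<^sup>2"
      using power_mono[OF \<phi>, of w 2] by simp
    \<comment> \<open>The residual of an increment given the next value of the walk has a smaller
      variance than the increment itself.\<close>
    moreover have "h * real l / (real l + 1) \<le> h"
      using h by (simp add: field_simps)
    ultimately have "\<theta>\<^sup>2 * (\<phi> w)\<^sup>2 * (h * real l / (real l + 1)) \<le> \<theta>\<^sup>2 * c\<^sup>2 * h"
      using h by (intro mult_mono mult_left_mono) auto
    then show "exp ((\<theta> * \<phi> w)\<^sup>2 * (h * real l / (real l + 1)) / 2) \<le> exp (\<theta>\<^sup>2 * c\<^sup>2 * h / 2)"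
      by (simp only: power_mult_distrib exp_le_cancel_iff divide_right_mono zero_le_numeral)
  qed simp
  also have "\<dots> = ennreal (exp (\<theta>\<^sup>2 * c\<^sup>2 * h / 2)) * (\<integral>\<^sup>+w. g w \<partial>gauss ((real l + 1) * h))"
    by (intro nn_integral_cmult) measurable
  also have "?e l * (ennreal (exp (\<theta>\<^sup>2 * c\<^sup>2 * h / 2)) * (\<integral>\<^sup>+w. g w \<partial>gauss ((real l + 1) * h)))
     = ?e (Suc l) * (\<integral>\<^sup>+w. g w \<partial>gauss (real (Suc l) * h))"
  proof -
    have "exp (\<theta>\<^sup>2 * c\<^sup>2 * h * real l / 2) * exp (\<theta>\<^sup>2 * c\<^sup>2 * h / 2) = exp (\<theta>\<^sup>2 * c\<^sup>2 * h * real (Suc l) / 2)"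
      unfolding exp_add[symmetric] by (simp add: field_simps)
    then have "?e l * ennreal (exp (\<theta>\<^sup>2 * c\<^sup>2 * h / 2)) = ?e (Suc l)"
      by (simp only: ennreal_mult[symmetric] exp_ge_zero)
    then show ?thesis
      by (simp only: mult.assoc[symmetric] of_nat_Suc add.commute)
  qed
  finally show ?case
    by (simp only: mult_left_mono zero_le)
qed

section \<open>Exponential moment of the drift\<close>

lemma gauss_prod_sum_mgf:
  assumes h: "h > 0" and J: "J \<subseteq> I" "finite I"
  shows "(\<integral>\<^sup>+x. ennreal (exp (a * sum x J)) \<partial>gauss_prod h I) = ennreal (exp (a\<^sup>2 * h * real (card J) / 2))"
proof -
  interpret product_sigma_finite "\<lambda>_::nat. gauss h"
    by (rule product_sigma_finite_gauss[OF h])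
  let ?a = "\<lambda>i. if i \<in> J then a else 0"
  have r: "J = I \<inter> J" using J by auto
  have "a * sum x J = (\<Sum>i\<in>I. ?a i * x i)" for x :: "nat \<Rightarrow> real"
    by (subst r, subst sum.inter_restrict[OF J(2)]) (auto simp: sum_distrib_left intro: sum.cong)
  then have "(\<integral>\<^sup>+x. ennreal (exp (a * sum x J)) \<partial>gauss_prod h I)
    = (\<integral>\<^sup>+x. (\<Prod>i\<in>I. ennreal (exp (?a i * x i))) \<partial>gauss_prod h I)"
    using J(2) by (simp only: exp_sum prod_ennreal exp_ge_zero)
  also have "\<dots> = (\<Prod>i\<in>I. ennreal (exp ((?a i)\<^sup>2 * h / 2)))"
    using J(2) by (subst product_nn_integral_prod) (auto simp only: gauss_mgf[OF h], measurable)
  also have "\<dots> = ennreal (exp (\<Sum>i\<in>I. (?a i)\<^sup>2 * h / 2))"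
    using J(2) by (simp only: exp_sum prod_ennreal exp_ge_zero)
  also have "(\<Sum>i\<in>I. (?a i)\<^sup>2 * h / 2) = (\<Sum>i\<in>J. a\<^sup>2 * h / 2)"
    by (subst (2) r, subst sum.inter_restrict[OF J(2)]) (auto intro: sum.cong)
  finally show ?thesis by simp
qed

lemma sum_inverse_sqrt_le: "(\<Sum>i=1..l. 1 / sqrt (real i)) \<le> 2 * sqrt (real l)"
proof (induction l)
  case (Suc l)
  have "sqrt (real l) * sqrt (real l + 1) \<le> real l + 1 / 2"
    using arith_geo_mean_sqrt[of "real l" "real l + 1"] by (simp add: real_sqrt_mult)
  then have "2 * sqrt (real l) + 1 / sqrt (real l + 1) \<le> 2 * sqrt (real l + 1)"
    by (simp add: field_simps)
  with Suc show ?case by (simp add: add.commute)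
qed simp

text \<open>The summand with index \<open>i\<close> has size \<open>sqrt (h / i)\<close>. Jensen's
  inequality with weights proportional to \<open>1 / sqrt i\<close> therefore gives every exponent
  the same variance \<open>\<kappa>\<^sup>2 s\<^sup>2 h\<close>, and \<open>s \<le> 2 sqrt l\<close>
  keeps it linear in \<open>l\<close>. The prefactor 2 comes from
  \<open>exp \<bar>v\<bar> \<le> exp v + exp (- v)\<close>.\<close>

lemma drift_mgf:
  assumes h: "h > 0" and l: "l > 0"
  shows "(\<integral>\<^sup>+x. ennreal (exp (\<kappa> * (\<Sum>i=1..l. \<bar>sum x {b..<b + i}\<bar> / real i))) \<partial>gauss_prod h {b..<b + l})
      \<le> ennreal (2 * exp (2 * \<kappa>\<^sup>2 * h * real l))"
proof -
  define s where "s = (\<Sum>i=1..l. 1 / sqrt (real i))"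
  define w where "w = (\<lambda>i. 1 / (sqrt (real i) * s))"
  have s: "s > 0" unfolding s_def using l by (intro sum_pos) auto
  have s2: "s\<^sup>2 \<le> 4 * real l"
    using power_mono[OF sum_inverse_sqrt_le[of l], of 2] s by (simp add: s_def power_mult_distrib)
  have w1: "(\<Sum>i=1..l. w i) = 1"
  proof -
    have "(\<Sum>i=1..l. w i) = (\<Sum>i=1..l. 1 / sqrt (real i)) / s"
      by (simp add: w_def sum_divide_distrib field_simps)
    then show ?thesis using s unfolding s_def[symmetric] by simp
  qed
  have w0: "w i \<ge> 0" for i using s by (simp add: w_def)
  define v where "v = (\<lambda>i x. \<kappa> * s / sqrt (real i) * sum x {b..<b + i})"
  have pt: "exp (\<kappa> * (\<Sum>i=1..l. \<bar>sum x {b..<b + i}\<bar> / real i))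
      \<le> (\<Sum>i=1..l. w i * (exp (v i x) + exp (- v i x)))" for x :: "nat \<Rightarrow> real"
  proof -
    let ?v = "\<lambda>i. \<kappa> * (s / sqrt (real i) * \<bar>sum x {b..<b + i}\<bar>)"
    have "\<kappa> * (\<bar>sum x {b..<b + i}\<bar> / real i) = w i *\<^sub>R ?v i" if "i \<in> {1..l}" for i
      using that s by (simp add: w_def)
    then have e: "\<kappa> * (\<Sum>i=1..l. \<bar>sum x {b..<b + i}\<bar> / real i) = (\<Sum>i=1..l. w i *\<^sub>R ?v i)"
      unfolding sum_distrib_left by (intro sum.cong refl) auto
    have "exp (\<Sum>i=1..l. w i *\<^sub>R ?v i) \<le> (\<Sum>i=1..l. w i * exp (?v i))"
      using l by (intro convex_on_sum[OF _ _ exp_convex] w1) (auto simp: w0)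
    also have "\<dots> \<le> (\<Sum>i=1..l. w i * (exp (v i x) + exp (- v i x)))"
      by (intro sum_mono mult_left_mono w0) (auto simp: v_def abs_if mult.assoc)
    finally show ?thesis unfolding e .
  qed
  have m: "(\<lambda>x. exp (a * sum x {b..<b + i})) \<in> borel_measurable (gauss_prod h {b..<b + l})"
    if "i \<le> l" for i a
    using that by (intro measurable_compose[OF measurable_gauss_prod_sum]) auto
  have mg: "(\<integral>\<^sup>+x. ennreal (exp (a * sum x {b..<b + i})) \<partial>gauss_prod h {b..<b + l})
      \<le> ennreal (exp (2 * \<kappa>\<^sup>2 * h * real l))"
    if "i \<in> {1..l}" "a = \<kappa> * s / sqrt (real i) \<or> a = - (\<kappa> * s / sqrt (real i))" for i a
  proof -
    have "a\<^sup>2 * real i = \<kappa>\<^sup>2 * s\<^sup>2"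
      using that by (auto simp: power_mult_distrib power_divide)
    then have "a\<^sup>2 * h * real i = \<kappa>\<^sup>2 * s\<^sup>2 * h" by (simp add: mult_ac)
    also have "\<dots> \<le> \<kappa>\<^sup>2 * (4 * real l) * h"
      using s2 h by (intro mult_right_mono mult_left_mono) auto
    finally show ?thesis
      using that(1) by (subst gauss_prod_sum_mgf[OF h]) (auto intro!: ennreal_leI simp: mult_ac)
  qed
  have "(\<integral>\<^sup>+x. ennreal (exp (\<kappa> * (\<Sum>i=1..l. \<bar>sum x {b..<b + i}\<bar> / real i))) \<partial>gauss_prod h {b..<b + l})
      \<le> (\<integral>\<^sup>+x. (\<Sum>i=1..l. ennreal (w i) * (ennreal (exp (v i x)) + ennreal (exp (- v i x)))) \<partial>gauss_prod h {b..<b + l})"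
    by (intro nn_integral_mono order_trans[OF ennreal_leI[OF pt]])
       (simp add: sum_ennreal w0 ennreal_mult[symmetric] ennreal_plus[symmetric] del: ennreal_plus)
  also have "\<dots> = (\<Sum>i=1..l. ennreal (w i) *
      ((\<integral>\<^sup>+x. ennreal (exp (v i x)) \<partial>gauss_prod h {b..<b + l}) +
       (\<integral>\<^sup>+x. ennreal (exp (- v i x)) \<partial>gauss_prod h {b..<b + l})))"
  proof -
    have [measurable]: "(\<lambda>x. exp (v i x)) \<in> borel_measurable (gauss_prod h {b..<b + l})"
      "(\<lambda>x. exp (- v i x)) \<in> borel_measurable (gauss_prod h {b..<b + l})" if "i \<in> {1..l}" for i
      using that m[of i "\<kappa> * s / sqrt (real i)"] m[of i "- (\<kappa> * s / sqrt (real i))"] by (auto simp: v_def)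
    show ?thesis
      by (subst nn_integral_sum) (auto simp: nn_integral_cmult nn_integral_add intro!: sum.cong)
  qed
  also have "\<dots> \<le> (\<Sum>i=1..l. ennreal (w i) * (ennreal (exp (2 * \<kappa>\<^sup>2 * h * real l)) + ennreal (exp (2 * \<kappa>\<^sup>2 * h * real l))))"
  proof (intro sum_mono mult_left_mono add_mono)
    fix i assume i: "i \<in> {1..l}"
    show "(\<integral>\<^sup>+x. ennreal (exp (v i x)) \<partial>gauss_prod h {b..<b + l}) \<le> ennreal (exp (2 * \<kappa>\<^sup>2 * h * real l))"
      unfolding v_def by (rule mg[OF i]) simp
    show "(\<integral>\<^sup>+x. ennreal (exp (- v i x)) \<partial>gauss_prod h {b..<b + l}) \<le> ennreal (exp (2 * \<kappa>\<^sup>2 * h * real l))"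
      unfolding v_def mult_minus_left[symmetric] by (rule mg[OF i]) simp
  qed simp_all
  also have "\<dots> = (\<Sum>i=1..l. ennreal (w i)) * ennreal (2 * exp (2 * \<kappa>\<^sup>2 * h * real l))"
    by (simp add: sum_distrib_right ennreal_plus[symmetric] del: ennreal_plus)
  also have "(\<Sum>i=1..l. ennreal (w i)) = 1"
    using w1 by (simp add: sum_ennreal w0)
  finally show ?thesis by simp
qed

text \<open>The covariation sum is a reversed martingale minus a forward martingale plus the drift of the
  reversed walk; the three exponential moments are combined by convexity.\<close>

lemma block_mgf:
  fixes \<phi> :: "real \<Rightarrow> real"
  assumes h: "h > 0" and m [measurable]: "\<phi> \<in> borel_measurable borel" and \<phi>: "\<And>u. \<bar>\<phi> u\<bar> \<le> c"
  shows "(\<integral>\<^sup>+x. ennreal (exp (\<theta> * (\<Sum>i<l. (\<phi> (sum x {b..<b + Suc i}) - \<phi> (sum x {b..<b + i})) * x (b + i))))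
            \<partial>gauss_prod h {b..<b + l}) \<le> ennreal (2 * exp (18 * \<theta>\<^sup>2 * c\<^sup>2 * h * real l))"
proof (cases "l = 0")
  case True
  then show ?thesis
    using prob_space.emeasure_space_1[OF prob_space_gauss_prod[OF h]]
    by simp
next
  case False
  let ?P = "gauss_prod h {b..<b + l}"
  define f where "f = (\<lambda>x. \<Sum>i<l. \<phi> (sum x {b..<b + i}) * x (b + i))"
  define r where "r = (\<lambda>x. \<Sum>i<l. \<phi> (sum x {b..<b + Suc i}) *
       (x (b + i) - sum x {b..<b + Suc i} / real (Suc i)))"
  define d where "d = (\<lambda>x::nat \<Rightarrow> real. \<Sum>i=1..l. \<bar>sum x {b..<b + i}\<bar> / real i)"
  let ?V = "\<lambda>x. \<Sum>i<l. (\<phi> (sum x {b..<b + Suc i}) - \<phi> (sum x {b..<b + i})) * x (b + i)"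
  have c: "c \<ge> 0" using \<phi>[of 0] by simp
  have [measurable]: "f \<in> borel_measurable ?P"
    unfolding f_def
    by (intro borel_measurable_sum borel_measurable_times measurable_compose[OF measurable_gauss_prod_sum]
        measurable_gauss_prod_component) auto
  have [measurable]: "r \<in> borel_measurable ?P"
    unfolding r_def
    by (intro borel_measurable_sum borel_measurable_times borel_measurable_diff borel_measurable_divide
        measurable_compose[OF measurable_gauss_prod_sum]
        measurable_gauss_prod_sum measurable_gauss_prod_component) auto
  have [measurable]: "d \<in> borel_measurable ?P"
    unfolding d_def
    by (intro borel_measurable_sum borel_measurable_divide borel_measurable_abs
        measurable_gauss_prod_sum) auto
  have pt: "exp (\<theta> * ?V x) \<le> 1 / 3 * (exp (3 * \<theta> * r x) + exp (3 * \<bar>\<theta>\<bar> * c * d x) + exp (- 3 * \<theta> * f x))" for x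
  proof -
    \<comment> \<open>\<open>e\<close> collects the drift of the reversed walk, the part of the
      backward sum that is not a martingale. It is merely bounded in absolute value, by
      \<open>c * d x\<close>.\<close>
    define e where "e = (\<Sum>i<l. \<phi> (sum x {b..<b + Suc i}) * (sum x {b..<b + Suc i} / real (Suc i)))"
    have V: "?V x = r x + e - f x"
      unfolding r_def e_def f_def sum.distrib[symmetric] sum_subtractf[symmetric]
      by (intro sum.cong refl) (simp add: algebra_simps del: sum.op_ivl_Suc)
    have "\<bar>e\<bar> \<le> (\<Sum>i<l. c * (\<bar>sum x {b..<b + Suc i}\<bar> / real (Suc i)))"
      unfolding e_def
      by (intro order_trans[OF sum_abs] sum_mono)
         (auto simp: abs_mult \<phi> simp del: sum.op_ivl_Suc of_nat_Suc intro!: divide_right_mono mult_right_mono)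
    also have "\<dots> = c * d x"
      unfolding d_def sum_distrib_left
      by (rule sum.reindex_bij_witness[where i = "\<lambda>i. i - 1" and j = Suc]) auto
    finally have e: "\<theta> * e \<le> \<bar>\<theta>\<bar> * c * d x"
      by (metis abs_ge_self abs_mult abs_ge_zero mult.assoc mult_left_mono order_trans)
    have "exp (\<theta> * ?V x) \<le> exp (\<Sum>i<3::nat. (1/3) *\<^sub>R [3 * \<theta> * r x, 3 * \<bar>\<theta>\<bar> * c * d x, - 3 * \<theta> * f x] ! i)"
      unfolding V using e by (simp add: numeral_3_eq_3 algebra_simps)
    also have "\<dots> \<le> (\<Sum>i<3::nat. (1/3) * exp ([3 * \<theta> * r x, 3 * \<bar>\<theta>\<bar> * c * d x, - 3 * \<theta> * f x] ! i))"
      by (intro convex_on_sum[OF _ _ exp_convex]) (auto simp: lessThan_empty_iff)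
    finally show ?thesis by (simp add: numeral_3_eq_3)
  qed
  have 1: "(\<integral>\<^sup>+x. ennreal (exp (3 * \<theta> * r x)) \<partial>?P) \<le> ennreal (exp (18 * \<theta>\<^sup>2 * c\<^sup>2 * h * real l))"
  proof -
    have "(\<integral>\<^sup>+x. ennreal (exp (3 * \<theta> * r x)) \<partial>?P) \<le> ennreal (exp ((3 * \<theta>)\<^sup>2 * c\<^sup>2 * h * real l / 2))"
      using backward_mgf[OF h m \<phi>, where g = "\<lambda>_. 1" and l = l and \<theta> = "3 * \<theta>" and b = b] False h
        prob_space.emeasure_space_1[OF prob_space_gauss[of "real l * h"]]
      by (simp add: r_def del: sum.op_ivl_Suc of_nat_Suc)
    also have "\<dots> \<le> ennreal (exp (18 * \<theta>\<^sup>2 * c\<^sup>2 * h * real l))"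
      using h by (intro ennreal_leI) (simp add: power_mult_distrib)
    finally show ?thesis .
  qed
  have 2: "(\<integral>\<^sup>+x. ennreal (exp (- 3 * \<theta> * f x)) \<partial>?P) \<le> ennreal (exp (18 * \<theta>\<^sup>2 * c\<^sup>2 * h * real l))"
  proof -
    have "(\<integral>\<^sup>+x. ennreal (exp (- 3 * \<theta> * f x)) \<partial>?P) \<le> ennreal (exp ((- 3 * \<theta>)\<^sup>2 * c\<^sup>2 * h * real l / 2))"
      unfolding f_def by (rule forward_mgf[OF h m \<phi>])
    also have "\<dots> \<le> ennreal (exp (18 * \<theta>\<^sup>2 * c\<^sup>2 * h * real l))"
      using h by (intro ennreal_leI) (simp add: power_mult_distrib)
    finally show ?thesis .
  qed
  \<comment> \<open>Splitting into three parts by convexity triples \<open>\<theta>\<close>. The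
    drift then contributes \<open>2 (3 \<theta> c)\<^sup>2 = 18 \<theta>\<^sup>2 c\<^sup>2\<close>,
    the worst of the three, as the martingale parts need only \<open>9 / 2\<close> in place of 18.
    The prefactor \<open>(1 + 2 + 1) / 3\<close> is rounded up to 2.\<close>
  have 3: "(\<integral>\<^sup>+x. ennreal (exp (3 * \<bar>\<theta>\<bar> * c * d x)) \<partial>?P) \<le> ennreal (2 * exp (18 * \<theta>\<^sup>2 * c\<^sup>2 * h * real l))"
    using drift_mgf[OF h, where l = l and \<kappa> = "3 * \<bar>\<theta>\<bar> * c" and b = b] False
    by (simp add: d_def power_mult_distrib mult.assoc)
  have "(\<integral>\<^sup>+x. ennreal (exp (\<theta> * ?V x)) \<partial>?P) \<le> (\<integral>\<^sup>+x. ennreal (1 / 3) * (ennreal (exp (3 * \<theta> * r x)) +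
      ennreal (exp (3 * \<bar>\<theta>\<bar> * c * d x)) + ennreal (exp (- 3 * \<theta> * f x))) \<partial>?P)"
    by (intro nn_integral_mono order_trans[OF ennreal_leI[OF pt]])
       (simp add: ennreal_mult[symmetric] ennreal_plus[symmetric] del: ennreal_plus)
  also have "\<dots> = ennreal (1 / 3) * ((\<integral>\<^sup>+x. ennreal (exp (3 * \<theta> * r x)) \<partial>?P) +
      (\<integral>\<^sup>+x. ennreal (exp (3 * \<bar>\<theta>\<bar> * c * d x)) \<partial>?P) + (\<integral>\<^sup>+x. ennreal (exp (- 3 * \<theta> * f x)) \<partial>?P))"
    by (simp add: nn_integral_cmult nn_integral_add)
  also have "\<dots> \<le> ennreal (1 / 3) * (ennreal (exp (18 * \<theta>\<^sup>2 * c\<^sup>2 * h * real l)) +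
      ennreal (2 * exp (18 * \<theta>\<^sup>2 * c\<^sup>2 * h * real l)) + ennreal (exp (18 * \<theta>\<^sup>2 * c\<^sup>2 * h * real l)))"
    by (intro mult_left_mono add_mono 1 2 3) simp
  also have "\<dots> \<le> ennreal (2 * exp (18 * \<theta>\<^sup>2 * c\<^sup>2 * h * real l))"
    by (auto simp: ennreal_plus[symmetric] ennreal_mult[symmetric] simp del: ennreal_plus intro!: ennreal_leI)
  finally show ?thesis .
qed

subsection \<open>Walks of several blocks\<close>

text \<open>Doob's maximal inequality for the exponential of the walk. The auxiliary
  \<open>?S\<close> is that exponential, frozen at \<open>exp r\<close> after the first passage;
  freezing can only lower the value at the passage, so each step multiplies the expectation by at
  most \<open>exp (a\<^sup>2 h / 2)\<close>. Markov's inequality for \<open>?S\<close>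
  concludes.\<close>

lemma gauss_walk_maximal:
  assumes h: "h > 0"
  shows "measure (gauss_prod h {b..<b + l}) {x \<in> space (gauss_prod h {b..<b + l}). \<exists>i\<le>l. r \<le> a * sum x {b..<b + i}}
     \<le> exp (a\<^sup>2 * h * real l / 2 - r)"
proof -
  let ?hit = "\<lambda>l x. \<exists>i\<in>{..l}. r \<le> a * sum x {b..<b + i}"
  let ?S = "\<lambda>l x. if ?hit l x then ennreal (exp r) else ennreal (exp (a * sum x {b..<b + l}))"
  have mhit: "Measurable.pred (gauss_prod h {b..<b + L}) (?hit l)" if "l \<le> L" for l L
  proof (rule pred_intros_finite)
    fix i assume "i \<in> {..l}"
    then have [measurable]: "(\<lambda>x. sum x {b..<b + i}) \<in> borel_measurable (gauss_prod h {b..<b + L})"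
      using that by (intro measurable_gauss_prod_sum) auto
    show "Measurable.pred (gauss_prod h {b..<b + L}) (\<lambda>x. r \<le> a * sum x {b..<b + i})"
      by measurable
  qed simp
  have mS: "?S l \<in> borel_measurable (gauss_prod h {b..<b + l})" for l
    using mhit[of l l] measurable_gauss_prod_sum[of "{b..<b + l}" "{b..<b + l}" h]
    by (intro measurable_If) measurable
  have bound: "(\<integral>\<^sup>+x. ?S l x \<partial>gauss_prod h {b..<b + l}) \<le> ennreal (exp (a\<^sup>2 * h * real l / 2))" for l
  proof (induction l)
    case 0
    have "(\<integral>\<^sup>+x. ?S 0 x \<partial>gauss_prod h {b..<b + 0}) \<le> (\<integral>\<^sup>+x. 1 \<partial>gauss_prod h {b..<b + 0})"
      by (intro nn_integral_mono) (auto simp: ennreal_le_1)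
    then show ?case
      using prob_space.emeasure_space_1[OF prob_space_gauss_prod[OF h]] by simp
  next
    case (Suc l)
    let ?e = "ennreal (exp (a\<^sup>2 * h / 2))"
    have le: "?S (Suc l) (x(b + l := y)) \<le>
       (if ?hit l x then ennreal (exp r) else ennreal (exp (a * sum x {b..<b + l})) * ennreal (exp (a * y)))" for x y
    proof -
      have "?hit (Suc l) (x(b + l := y)) \<longleftrightarrow> ?hit l x \<or> r \<le> a * (sum x {b..<b + l} + y)"
        by (simp only: atMost_Suc bex_simps sum_interval_upd(2))
           (auto simp: sum_interval_upd)
      then show ?thesis
        by (simp only: sum_interval_upd(2))
           (auto simp: ennreal_mult[symmetric] exp_add[symmetric] distrib_left intro!: ennreal_leI)
    qed
    have "(\<integral>\<^sup>+x. ?S (Suc l) x \<partial>gauss_prod h {b..<b + Suc l})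
      = (\<integral>\<^sup>+x. (\<integral>\<^sup>+y. ?S (Suc l) (x(b + l := y)) \<partial>gauss h) \<partial>gauss_prod h {b..<b + l})"
      by (rule gauss_prod_peel(1)[OF h mS])
    also have "\<dots> \<le> (\<integral>\<^sup>+x. (\<integral>\<^sup>+y. (if ?hit l x then ennreal (exp r)
        else ennreal (exp (a * sum x {b..<b + l})) * ennreal (exp (a * y))) \<partial>gauss h) \<partial>gauss_prod h {b..<b + l})"
      by (intro nn_integral_mono le)
    also have "\<dots> \<le> (\<integral>\<^sup>+x. ?S l x * ?e \<partial>gauss_prod h {b..<b + l})"
    proof (intro nn_integral_mono)
      fix x
      show "(\<integral>\<^sup>+y. (if ?hit l x then ennreal (exp r)
        else ennreal (exp (a * sum x {b..<b + l})) * ennreal (exp (a * y))) \<partial>gauss h) \<le> ?S l x * ?e"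
      proof (cases "?hit l x")
        case True
        have "ennreal (exp r) * 1 \<le> ennreal (exp r) * ?e"
          using h by (intro mult_left_mono) (auto simp: ennreal_1[symmetric] simp del: ennreal_1)
        with True show ?thesis
          using prob_space.emeasure_space_1[OF prob_space_gauss[OF h]] by simp
      next
        case False
        then show ?thesis
          by (simp only: if_False nn_integral_cmult gauss_mgf[OF h]) (simp add: nn_integral_cmult gauss_mgf[OF h])
      qed
    qed
    also have "\<dots> = (\<integral>\<^sup>+x. ?S l x \<partial>gauss_prod h {b..<b + l}) * ?e"
      by (intro nn_integral_multc mS)
    also have "\<dots> \<le> ennreal (exp (a\<^sup>2 * h * real l / 2)) * ?e"
      by (intro mult_right_mono Suc) simp
    also have "\<dots> = ennreal (exp (a\<^sup>2 * h * real (Suc l) / 2))"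
      by (simp add: ennreal_mult[symmetric] exp_add[symmetric] field_simps)
    finally show ?case .
  qed
  interpret prob_space "gauss_prod h {b..<b + l}" by (rule prob_space_gauss_prod[OF h])
  let ?A = "{x \<in> space (gauss_prod h {b..<b + l}). ?hit l x}"
  have A [measurable]: "?A \<in> events" using mhit[of l l] by measurable
  have "ennreal (exp r * prob ?A) = (\<integral>\<^sup>+x. ennreal (exp r) * indicator ?A x \<partial>gauss_prod h {b..<b + l})"
    by (subst nn_integral_cmult_indicator) (auto simp: emeasure_eq_measure ennreal_mult)
  also have "\<dots> \<le> (\<integral>\<^sup>+x. ?S l x \<partial>gauss_prod h {b..<b + l})"
    by (intro nn_integral_mono) (auto simp: indicator_def)
  also note bound
  finally have "exp r * prob ?A \<le> exp (a\<^sup>2 * h * real l / 2)" by simp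
  then have "prob ?A \<le> exp (a\<^sup>2 * h * real l / 2 - r)"
    by (simp only: exp_diff pos_le_divide_eq exp_gt_zero mult.commute)
  moreover have "?A = {x \<in> space (gauss_prod h {b..<b + l}). \<exists>i\<le>l. r \<le> a * sum x {b..<b + i}}"
    by auto
  ultimately show ?thesis by simp
qed

text \<open>Here \<open>x\<close> lists the increments of the walk, and the partial sum up to \<open>m\<close> is the reference point
  from which \<open>\<phi>\<close> measures the increment of the integrand.\<close>

definition cstep :: "(real \<Rightarrow> real \<Rightarrow> real) \<Rightarrow> nat \<Rightarrow> nat \<Rightarrow> (nat \<Rightarrow> real) \<Rightarrow> real" where
  "cstep \<phi> m i x = (\<phi> (sum x {..<m}) (sum x {..<Suc i}) - \<phi> (sum x {..<m}) (sum x {..<i})) * x i"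

lemma measurable_cstep:
  assumes [measurable]: "case_prod \<phi> \<in> borel_measurable (borel \<Otimes>\<^sub>M borel)" and "m \<le> N" "i < N"
  shows "cstep \<phi> m i \<in> borel_measurable (gauss_prod h {..<N})"
proof -
  have [measurable]: "(\<lambda>x. sum x {..<m}) \<in> borel_measurable (gauss_prod h {..<N})"
    "(\<lambda>x. sum x {..<Suc i}) \<in> borel_measurable (gauss_prod h {..<N})"
    "(\<lambda>x. sum x {..<i}) \<in> borel_measurable (gauss_prod h {..<N})"
    "(\<lambda>x. x i) \<in> borel_measurable (gauss_prod h {..<N})"
    using assms(2,3) by (auto intro!: measurable_gauss_prod_sum measurable_gauss_prod_component simp del: sum.lessThan_Suc)
  show ?thesis unfolding cstep_def by measurable
qed

lemma cstep_cong:
  "m \<le> N \<Longrightarrow> i < N \<Longrightarrow> (\<And>j. j < N \<Longrightarrow> x j = y j) \<Longrightarrow> cstep \<phi> m i x = cstep \<phi> m i y"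
  unfolding cstep_def
  by (intro arg_cong2[where f = "(*)"] arg_cong2[where f = "(-)"] arg_cong2[where f = \<phi>] sum.cong) auto

text \<open>With the increments before \<open>b\<close> fixed, the sum is a covariation sum of a
  fresh walk with integrand \<open>\<psi>\<close>, and \<open>block_mgf\<close> applies. The
  reference index \<open>m\<close> may precede \<open>b\<close>, as needed for dyadic intervals
  inside a block. The factor \<open>H\<close> carries the earlier blocks; it is read on both product
  spaces, and \<open>dep\<close> says that it depends on the past alone.\<close>

lemma block_mgf_past:
  assumes h: "h > 0" and m: "case_prod \<phi> \<in> borel_measurable (borel \<Otimes>\<^sub>M borel)"
    and \<phi>: "\<And>z u. \<bar>\<phi> z u\<bar> \<le> c" and mb: "m \<le> b"
    and H: "H \<in> borel_measurable (gauss_prod h {..<b})" "H \<in> borel_measurable (gauss_prod h {..<b + l})"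
    and dep: "\<And>x y. (\<And>j. j < b \<Longrightarrow> x j = y j) \<Longrightarrow> H x = H y"
  shows "(\<integral>\<^sup>+x. H x * ennreal (exp (\<theta> * (\<Sum>i<l. cstep \<phi> m (b + i) x))) \<partial>gauss_prod h {..<b + l})
    \<le> ennreal (2 * exp (18 * \<theta>\<^sup>2 * c\<^sup>2 * h * real l)) * (\<integral>\<^sup>+x. H x \<partial>gauss_prod h {..<b})"
proof -
  interpret product_sigma_finite "\<lambda>_::nat. gauss h"
    by (rule product_sigma_finite_gauss[OF h])
  let ?C = "ennreal (2 * exp (18 * \<theta>\<^sup>2 * c\<^sup>2 * h * real l))"
  let ?F = "\<lambda>x. H x * ennreal (exp (\<theta> * (\<Sum>i<l. cstep \<phi> m (b + i) x)))"
  have I: "{..<b + l} = {..<b} \<union> {b..<b + l}" "{..<b} \<inter> {b..<b + l} = {}" by auto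
  have mC: "cstep \<phi> m (b + i) \<in> borel_measurable (gauss_prod h {..<b + l})" if "i < l" for i
    using that mb by (intro measurable_cstep m) auto
  have mF: "?F \<in> borel_measurable (gauss_prod h ({..<b} \<union> {b..<b + l}))"
    unfolding I(1)[symmetric]
    by (intro borel_measurable_times_ennreal H measurable_compose[OF _ measurable_ennreal]
        measurable_compose[OF _ borel_measurable_exp] borel_measurable_times borel_measurable_const borel_measurable_sum)
       (auto intro!: mC)
  have "integral\<^sup>N (gauss_prod h {..<b + l}) ?F =
      (\<integral>\<^sup>+x. (\<integral>\<^sup>+y. ?F (merge {..<b} {b..<b + l} (x, y)) \<partial>gauss_prod h {b..<b + l}) \<partial>gauss_prod h {..<b})"
    unfolding I(1) by (rule product_nn_integral_fold[OF I(2) _ _ mF]) auto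
  also have "\<dots> \<le> (\<integral>\<^sup>+x. ?C * H x \<partial>gauss_prod h {..<b})"
  proof (intro nn_integral_mono)
    fix x :: "nat \<Rightarrow> real"
    let ?g = "\<lambda>y. merge {..<b} {b..<b + l} (x, y)"
    define \<psi> where "\<psi> u = \<phi> (sum x {..<m}) (sum x {..<b} + u)" for u
    note m [measurable]
    have [measurable]: "\<psi> \<in> borel_measurable borel" unfolding \<psi>_def by measurable
    have HH: "H (?g y) = H x" for y by (rule dep) (auto simp: merge_def)
    have s1: "sum (?g y) {..<j} = sum x {..<j}" if "j \<le> b" for y j
      using that by (intro sum.cong) (auto simp: merge_def)
    have s2: "sum (?g y) {..<b + i} = sum x {..<b} + sum y {b..<b + i}" if "i \<le> l" for y i
    proof -
      have "{..<b + i} = {..<b} \<union> {b..<b + i}" by auto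
      then have "sum (?g y) {..<b + i} = sum (?g y) {..<b} + sum (?g y) {b..<b + i}"
        by (simp add: sum.union_disjoint ivl_disj_int)
      also have "sum (?g y) {b..<b + i} = sum y {b..<b + i}"
        using that by (intro sum.cong) (auto simp: merge_def)
      finally show ?thesis by (simp add: s1)
    qed
    have c: "cstep \<phi> m (b + i) (?g y) = (\<psi> (sum y {b..<b + Suc i}) - \<psi> (sum y {b..<b + i})) * y (b + i)"
      if "i < l" for y i
    proof -
      have "?g y (b + i) = y (b + i)" using that by (auto simp: merge_def)
      moreover have "sum (?g y) {..<Suc (b + i)} = sum x {..<b} + sum y {b..<b + Suc i}"
        using s2[of "Suc i" y] that by (simp del: sum.op_ivl_Suc sum.lessThan_Suc)
      ultimately show ?thesis
        unfolding cstep_def \<psi>_def using that by (simp only: s1[OF mb] s2 less_imp_le)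
    qed
    have mV: "(\<lambda>y. \<Sum>i<l. (\<psi> (sum y {b..<b + Suc i}) - \<psi> (sum y {b..<b + i})) * y (b + i))
        \<in> borel_measurable (gauss_prod h {b..<b + l})"
      by (intro borel_measurable_sum borel_measurable_times borel_measurable_diff
          measurable_compose[OF measurable_gauss_prod_sum] measurable_gauss_prod_component) auto
    have "(\<integral>\<^sup>+y. ?F (?g y) \<partial>gauss_prod h {b..<b + l}) = (\<integral>\<^sup>+y. H x * ennreal (exp (\<theta> *
        (\<Sum>i<l. (\<psi> (sum y {b..<b + Suc i}) - \<psi> (sum y {b..<b + i})) * y (b + i)))) \<partial>gauss_prod h {b..<b + l})"
      by (simp add: HH c del: sum.op_ivl_Suc)
    also have "\<dots> = H x * (\<integral>\<^sup>+y. ennreal (exp (\<theta> *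
        (\<Sum>i<l. (\<psi> (sum y {b..<b + Suc i}) - \<psi> (sum y {b..<b + i})) * y (b + i)))) \<partial>gauss_prod h {b..<b + l})"
      using mV by (intro nn_integral_cmult) measurable
    also have "\<dots> \<le> H x * ?C"
      by (intro mult_left_mono block_mgf[OF h]) (auto simp: \<psi>_def \<phi>)
    finally show "(\<integral>\<^sup>+y. ?F (?g y) \<partial>gauss_prod h {b..<b + l}) \<le> ?C * H x"
      by (simp add: mult.commute)
  qed
  also have "\<dots> = ?C * (\<integral>\<^sup>+x. H x \<partial>gauss_prod h {..<b})"
    by (intro nn_integral_cmult H)
  finally show ?thesis .
qed

lemma sum_lessThan_add:
  fixes g :: "nat \<Rightarrow> real"
  shows "sum g {..<a + l} = sum g {..<a} + (\<Sum>i<l. g (a + i))"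
  by (induction l) (simp_all add: add.assoc)

text \<open>\<open>i div L * L\<close> is the first index of the block containing \<open>i\<close>,
  so every block has its own reference point. Splitting off the last block with
  \<open>block_mgf_past\<close> costs a factor 2 each time.\<close>

lemma multi_block_mgf:
  assumes h: "h > 0" and m: "case_prod \<phi> \<in> borel_measurable (borel \<Otimes>\<^sub>M borel)"
    and \<phi>: "\<And>z u. \<bar>\<phi> z u\<bar> \<le> c" and L: "L > 0"
  shows "(\<integral>\<^sup>+x. ennreal (exp (\<theta> * (\<Sum>i<K * L. cstep \<phi> (i div L * L) i x))) \<partial>gauss_prod h {..<K * L})
    \<le> ennreal (2 ^ K * exp (18 * \<theta>\<^sup>2 * c\<^sup>2 * h * real (K * L)))"
proof (induction K)
  case 0
  then show ?case
    using prob_space.emeasure_space_1[OF prob_space_gauss_prod[OF h]] by simp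
next
  case (Suc K)
  let ?S = "\<lambda>K x. \<Sum>i<K * L. cstep \<phi> (i div L * L) i x"
  let ?H = "\<lambda>x. ennreal (exp (\<theta> * ?S K x))"
  have mS: "?S K \<in> borel_measurable (gauss_prod h {..<N})" if "K * L \<le> N" for N
  proof (intro borel_measurable_sum measurable_cstep m)
    fix i assume "i \<in> {..<K * L}"
    then have "i < N" using that by auto
    moreover have "i div L * L \<le> i" by simp
    ultimately show "i div L * L \<le> N" "i < N" by linarith+
  qed
  have split: "?S (Suc K) x = ?S K x + (\<Sum>i<L. cstep \<phi> (K * L) (K * L + i) x)" for x
  proof -
    have "?S (Suc K) x = (\<Sum>i<K * L + L. cstep \<phi> (i div L * L) i x)" by (simp add: add.commute)
    also have "\<dots> = ?S K x + (\<Sum>i<L. cstep \<phi> ((K * L + i) div L * L) (K * L + i) x)"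
      by (rule sum_lessThan_add)
    finally show ?thesis using L by simp
  qed
  have "(\<integral>\<^sup>+x. ennreal (exp (\<theta> * ?S (Suc K) x)) \<partial>gauss_prod h {..<Suc K * L})
    = (\<integral>\<^sup>+x. ?H x * ennreal (exp (\<theta> * (\<Sum>i<L. cstep \<phi> (K * L) (K * L + i) x))) \<partial>gauss_prod h {..<K * L + L})"
  proof -
    have "Suc K * L = K * L + L" by simp
    then show ?thesis
      unfolding split by (simp only: distrib_left exp_add ennreal_mult exp_ge_zero)
  qed
  also have "\<dots> \<le> ennreal (2 * exp (18 * \<theta>\<^sup>2 * c\<^sup>2 * h * real L)) * (\<integral>\<^sup>+x. ?H x \<partial>gauss_prod h {..<K * L})"
  proof (intro block_mgf_past[OF h m \<phi>])
    show "?H \<in> borel_measurable (gauss_prod h {..<K * L})" using mS[of "K * L"] by measurable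
    show "?H \<in> borel_measurable (gauss_prod h {..<K * L + L})" using mS[of "K * L + L"] by measurable
    fix x y :: "nat \<Rightarrow> real" assume "\<And>j. j < K * L \<Longrightarrow> x j = y j"
    moreover have "i div L * L \<le> K * L" if "i < K * L" for i
      using that by (meson div_times_less_eq_dividend less_imp_le order_trans)
    ultimately have "?S K x = ?S K y"
      by (intro sum.cong refl cstep_cong[where N = "K * L"]) auto
    then show "?H x = ?H y" by simp
  qed simp
  also have "\<dots> \<le> ennreal (2 * exp (18 * \<theta>\<^sup>2 * c\<^sup>2 * h * real L)) *
      ennreal (2 ^ K * exp (18 * \<theta>\<^sup>2 * c\<^sup>2 * h * real (K * L)))"
    by (intro mult_left_mono Suc) simp
  also have "\<dots> = ennreal (2 ^ Suc K * exp (18 * \<theta>\<^sup>2 * c\<^sup>2 * h * real (Suc K * L)))"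
  proof -
    have "2 * exp (18 * \<theta>\<^sup>2 * c\<^sup>2 * h * real L) * (2 ^ K * exp (18 * \<theta>\<^sup>2 * c\<^sup>2 * h * real (K * L)))
       = 2 ^ Suc K * (exp (18 * \<theta>\<^sup>2 * c\<^sup>2 * h * real L) * exp (18 * \<theta>\<^sup>2 * c\<^sup>2 * h * real (K * L)))" by simp
    also have "\<dots> = 2 ^ Suc K * exp (18 * \<theta>\<^sup>2 * c\<^sup>2 * h * real (Suc K * L))"
      unfolding exp_add[symmetric] by (simp add: algebra_simps)
    finally show ?thesis by (simp add: ennreal_mult[symmetric] del: power_Suc)
  qed
  finally show ?case .
qed

section \<open>From exponential moments to tails\<close>

lemma (in prob_space) two_sided_chernoff:
  assumes [measurable]: "X \<in> borel_measurable M" and v: "v > 0" and a: "a > 0" and B: "B \<ge> 0"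
    and mgf: "\<And>\<theta>. (\<integral>\<^sup>+\<omega>. ennreal (exp (\<theta> * X \<omega>)) \<partial>M) \<le> ennreal (B * exp (v * \<theta>\<^sup>2))"
  shows "prob {\<omega> \<in> space M. \<bar>X \<omega>\<bar> > a} \<le> 2 * B * exp (- (a\<^sup>2 / (4 * v)))"
proof -
  \<comment> \<open>The minimizer of \<open>v \<theta>\<^sup>2 - \<theta> a\<close>; the minimum is
    \<open>- a\<^sup>2 / (4 v)\<close>.\<close>
  define \<theta> where "\<theta> = a / (2 * v)"
  let ?A = "{\<omega> \<in> space M. \<bar>X \<omega>\<bar> > a}"
  have t: "\<theta> > 0" using a v by (simp add: \<theta>_def)
  have "ennreal (exp (\<theta> * a) * prob ?A) = (\<integral>\<^sup>+\<omega>. ennreal (exp (\<theta> * a)) * indicator ?A \<omega> \<partial>M)"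
    by (subst nn_integral_cmult_indicator) (auto simp: emeasure_eq_measure ennreal_mult)
  also have "\<dots> \<le> (\<integral>\<^sup>+\<omega>. ennreal (exp (\<theta> * X \<omega>)) + ennreal (exp (- \<theta> * X \<omega>)) \<partial>M)"
  proof (intro nn_integral_mono)
    fix \<omega>
    show "ennreal (exp (\<theta> * a)) * indicator ?A \<omega> \<le> ennreal (exp (\<theta> * X \<omega>)) + ennreal (exp (- \<theta> * X \<omega>))"
    proof (cases "\<omega> \<in> ?A")
      case True
      have "exp (\<theta> * a) \<le> exp (\<theta> * X \<omega>) + exp (- \<theta> * X \<omega>)"
      proof (cases "X \<omega> \<ge> 0")
        case True
        then have "exp (\<theta> * a) \<le> exp (\<theta> * X \<omega>)" using \<open>\<omega> \<in> ?A\<close> t by simp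
        then show ?thesis by (smt (verit) exp_gt_zero)
      next
        case False
        then have "exp (\<theta> * a) \<le> exp (\<theta> * (- X \<omega>))"
          using \<open>\<omega> \<in> ?A\<close> t by (subst exp_le_cancel_iff) (intro mult_left_mono, auto)
        then show ?thesis using exp_gt_zero[of "\<theta> * X \<omega>"] unfolding mult_minus_right mult_minus_left by linarith
      qed
      then show ?thesis using True
        by (simp add: ennreal_plus[symmetric] ennreal_leI del: ennreal_plus)
    qed simp
  qed
  also have "\<dots> = (\<integral>\<^sup>+\<omega>. ennreal (exp (\<theta> * X \<omega>)) \<partial>M) + (\<integral>\<^sup>+\<omega>. ennreal (exp (- \<theta> * X \<omega>)) \<partial>M)"
    by (intro nn_integral_add) measurable
  also have "\<dots> \<le> ennreal (B * exp (v * \<theta>\<^sup>2)) + ennreal (B * exp (v * \<theta>\<^sup>2))"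
    using mgf[of \<theta>] mgf[of "- \<theta>"] by (intro add_mono) auto
  also have "\<dots> = ennreal (2 * B * exp (v * \<theta>\<^sup>2))"
    using B by (simp add: ennreal_plus[symmetric] del: ennreal_plus)
  finally have "exp (\<theta> * a) * prob ?A \<le> 2 * B * exp (v * \<theta>\<^sup>2)"
    using B by simp
  then have "prob ?A \<le> 2 * B * (exp (v * \<theta>\<^sup>2) / exp (\<theta> * a))"
    by (simp add: field_simps)
  also have "exp (v * \<theta>\<^sup>2) / exp (\<theta> * a) = exp (- (a\<^sup>2 / (4 * v)))"
    unfolding exp_diff[symmetric] using v by (simp add: \<theta>_def field_simps power2_eq_square)
  finally show ?thesis .
qed

subsection \<open>Brownian motion on a grid\<close>

lemma brownian_motionD:
  assumes "brownian_motion M W"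
  shows "prob_space M" "\<And>t. t \<ge> 0 \<Longrightarrow> W t \<in> borel_measurable M"
    "\<And>\<omega>. \<omega> \<in> space M \<Longrightarrow> W 0 \<omega> = 0"
  using assms unfolding brownian_motion_def by auto

text \<open>The restriction to \<open>I\<close> puts the values into the extensional function space
  underlying \<open>gauss_prod h I\<close>.\<close>

definition increments :: "(real \<Rightarrow> 'a \<Rightarrow> real) \<Rightarrow> real \<Rightarrow> nat set \<Rightarrow> 'a \<Rightarrow> nat \<Rightarrow> real" where
  "increments W h I \<omega> = (\<lambda>i\<in>I. W (real (Suc i) * h) \<omega> - W (real i * h) \<omega>)"

lemma measurable_increments:
  assumes BM: "brownian_motion M W" and h: "h > 0"
  shows "increments W h I \<in> measurable M (gauss_prod h I)"
proof -
  have [measurable]: "W t \<in> borel_measurable M" if "t \<ge> 0" for t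
    using brownian_motionD(2)[OF BM that] .
  show ?thesis
    unfolding increments_def using h by (intro measurable_restrict) simp
qed

lemma distr_increments:
  assumes BM: "brownian_motion M W" and h: "h > 0" and I: "finite I"
  shows "distr M (gauss_prod h I) (increments W h I) = gauss_prod h I"
\<comment> \<open>The characterisation of independence by product distributions requires a nonempty
  index set. For \<open>I = {}\<close> both sides are probability measures on a one-point
  space.\<close>
proof (cases "I = {}")
  case True
  interpret M: prob_space M by (rule brownian_motionD[OF BM])
  interpret G: prob_space "gauss_prod h {}" by (rule prob_space_gauss_prod[OF h])
  interpret D: prob_space "distr M (gauss_prod h {}) (increments W h {})"
    by (rule M.prob_space_distr[OF measurable_increments[OF BM h]])
  have "A = {} \<or> A = space (gauss_prod h {})" if "A \<in> sets (gauss_prod h {})" for A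
    using that by (auto simp: PiM_empty)
  then show ?thesis
    unfolding True using G.emeasure_space_1 D.emeasure_space_1
    by (intro measure_eqI) (simp, metis emeasure_empty sets_distr space_distr)
next
  case False
  interpret M: prob_space M by (rule brownian_motionD[OF BM])
  let ?Y = "\<lambda>i \<omega>. W (real (Suc i) * h) \<omega> - W (real i * h) \<omega>"
  have W: "W t \<in> borel_measurable M" if "t \<ge> 0" for t
    using brownian_motionD(2)[OF BM that] .
  have Y: "?Y i \<in> borel_measurable M" for i
    using h by (intro borel_measurable_diff W) auto
  obtain m where m: "I \<subseteq> {..<m}" using I finite_nat_set_iff_bounded by auto
  have "\<forall>(m::nat) (t::nat \<Rightarrow> real). 0 \<le> t 0 \<longrightarrow> (\<forall>i<m. t i \<le> t (Suc i)) \<longrightarrow>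
        prob_space.indep_vars M (\<lambda>_. borel) (\<lambda>i \<omega>. W (t (Suc i)) \<omega> - W (t i) \<omega>) {..<m}"
    using BM unfolding brownian_motion_def by blast
  from this[rule_format, of "\<lambda>i. real i * h" m] have "M.indep_vars (\<lambda>_. borel) ?Y {..<m}"
    using h by (auto simp: mult_right_mono)
  then have "M.indep_vars (\<lambda>_. borel) ?Y I" by (rule M.indep_vars_subset[OF _ m])
  then have "distr M (\<Pi>\<^sub>M i\<in>I. borel) (\<lambda>x. \<lambda>i\<in>I. ?Y i x) = (\<Pi>\<^sub>M i\<in>I. distr M borel (?Y i))"
    by (subst (asm) M.indep_vars_iff_distr_eq_PiM'[OF False Y])
  also have "\<dots> = gauss_prod h I"
  proof (rule PiM_cong[OF refl])
    fix i
    have "\<forall>s t. 0 \<le> s \<longrightarrow> s < t \<longrightarrow>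
        distributed M lborel (\<lambda>\<omega>. W t \<omega> - W s \<omega>) (normal_density 0 (sqrt (t - s)))"
      using BM unfolding brownian_motion_def by blast
    from this[rule_format, of "real i * h" "real (Suc i) * h"]
    have "distributed M lborel (?Y i) (normal_density 0 (sqrt h))"
      using h by (simp add: algebra_simps)
    from distributed_distr_eq_density[OF this] have "distr M lborel (?Y i) = gauss h"
      by (simp add: gauss_def)
    moreover have "distr M lborel (?Y i) = distr M borel (?Y i)"
      by (intro distr_cong) auto
    ultimately show "distr M borel (?Y i) = gauss h" by simp
  qed
  also have "distr M (\<Pi>\<^sub>M i\<in>I. borel) (\<lambda>x. \<lambda>i\<in>I. ?Y i x) = distr M (gauss_prod h I) (increments W h I)"
    by (intro distr_cong sets_PiM_cong) (auto simp: increments_def)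
  finally show ?thesis .
qed

lemma nn_integral_increments:
  assumes BM: "brownian_motion M W" and h: "h > 0" and I: "finite I"
    and F: "F \<in> borel_measurable (gauss_prod h I)"
  shows "(\<integral>\<^sup>+\<omega>. F (increments W h I \<omega>) \<partial>M) = (\<integral>\<^sup>+x. F x \<partial>gauss_prod h I)"
  by (subst distr_increments[OF BM h I, symmetric])
     (simp add: nn_integral_distr[OF measurable_increments[OF BM h]] F)

lemma sum_increments:
  assumes "{a..<a + i} \<subseteq> I"
  shows "sum (increments W h I \<omega>) {a..<a + i} = W (real (a + i) * h) \<omega> - W (real a * h) \<omega>"
proof -
  have "sum (increments W h I \<omega>) {a..<a + i} = (\<Sum>j=a..<a + i. W (real (Suc j) * h) \<omega> - W (real j * h) \<omega>)"
    using assms by (intro sum.cong) (auto simp: increments_def)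
  also have "\<dots> = W (real (a + i) * h) \<omega> - W (real a * h) \<omega>"
    by (rule sum_Suc_diff'[where f = "\<lambda>j. W (real j * h) \<omega>"]) simp
  finally show ?thesis .
qed

definition pstep :: "(real \<Rightarrow> 'a \<Rightarrow> real) \<Rightarrow> (real \<Rightarrow> real \<Rightarrow> real) \<Rightarrow> real \<Rightarrow> nat \<Rightarrow> nat \<Rightarrow> 'a \<Rightarrow> real" where
  "pstep W \<phi> h m i \<omega> =
    (\<phi> (W (real m * h) \<omega>) (W (real (Suc i) * h) \<omega>) - \<phi> (W (real m * h) \<omega>) (W (real i * h) \<omega>))
      * (W (real (Suc i) * h) \<omega> - W (real i * h) \<omega>)"

text \<open>Partial sums of the increments are values of the path because \<open>W 0 = 0\<close>;
  this carries the estimates for Gaussian products over to \<open>W\<close>.\<close>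

lemma cstep_increments:
  assumes BM: "brownian_motion M W" and \<omega>: "\<omega> \<in> space M" and "m \<le> N" "i < N"
  shows "cstep \<phi> m i (increments W h {..<N} \<omega>) = pstep W \<phi> h m i \<omega>"
proof -
  have s: "sum (increments W h {..<N} \<omega>) {..<j} = W (real j * h) \<omega>" if "j \<le> N" for j
    using sum_increments[of 0 j "{..<N}" W h \<omega>] that brownian_motionD(3)[OF BM \<omega>]
    by (auto simp: atLeast0LessThan)
  have "increments W h {..<N} \<omega> i = W (real (Suc i) * h) \<omega> - W (real i * h) \<omega>"
    using assms by (simp add: increments_def)
  with s[of m] s[of i] s[of "Suc i"] show ?thesis
    using assms(3,4) unfolding cstep_def pstep_def by (simp del: sum.lessThan_Suc of_nat_Suc)
qed

lemma measurable_pstep: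
  assumes BM: "brownian_motion M W" and h: "h > 0"
    and [measurable]: "case_prod \<phi> \<in> borel_measurable (borel \<Otimes>\<^sub>M borel)"
  shows "pstep W \<phi> h m i \<in> borel_measurable M"
proof -
  have [measurable]: "W (real j * h) \<in> borel_measurable M" for j
    using h by (simp add: brownian_motionD(2)[OF BM])
  show ?thesis unfolding pstep_def by measurable
qed

text \<open>The Chernoff bound with \<open>B = 2\<close> and \<open>v = 18 c\<^sup>2 h l\<close>,
  whence \<open>4 = 2 * 2\<close> and \<open>72 = 4 * 18\<close>. The past factor is
  \<open>H = 1\<close>.\<close>

lemma block_tail:
  assumes BM: "brownian_motion M W" and h: "h > 0"
    and m: "case_prod \<phi> \<in> borel_measurable (borel \<Otimes>\<^sub>M borel)"
    and \<phi>: "\<And>z u. \<bar>\<phi> z u\<bar> \<le> c" and c: "c > 0" and mb: "m \<le> b" and l: "l > 0" and a: "a > 0"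
  shows "measure M {\<omega> \<in> space M. \<bar>\<Sum>i<l. pstep W \<phi> h m (b + i) \<omega>\<bar> > a}
      \<le> 4 * exp (- (a\<^sup>2 / (72 * c\<^sup>2 * (h * real l))))"
proof -
  interpret prob_space M by (rule brownian_motionD[OF BM])
  have "prob {\<omega> \<in> space M. \<bar>\<Sum>i<l. pstep W \<phi> h m (b + i) \<omega>\<bar> > a}
      \<le> 2 * 2 * exp (- (a\<^sup>2 / (4 * (18 * c\<^sup>2 * (h * real l)))))"
  proof (rule two_sided_chernoff)
    show "(\<lambda>\<omega>. \<Sum>i<l. pstep W \<phi> h m (b + i) \<omega>) \<in> borel_measurable M"
      by (intro borel_measurable_sum measurable_pstep[OF BM h m])
    fix \<theta>
    let ?F = "\<lambda>x. ennreal (exp (\<theta> * (\<Sum>i<l. cstep \<phi> m (b + i) x)))"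
    have "(\<lambda>x. \<Sum>i<l. cstep \<phi> m (b + i) x) \<in> borel_measurable (gauss_prod h {..<b + l})"
      using mb by (intro borel_measurable_sum measurable_cstep m) auto
    then have F: "?F \<in> borel_measurable (gauss_prod h {..<b + l})" by measurable
    have "(\<integral>\<^sup>+\<omega>. ennreal (exp (\<theta> * (\<Sum>i<l. pstep W \<phi> h m (b + i) \<omega>))) \<partial>M)
      = (\<integral>\<^sup>+\<omega>. ?F (increments W h {..<b + l} \<omega>) \<partial>M)"
      using mb by (intro nn_integral_cong) (simp add: cstep_increments[OF BM])
    also have "\<dots> = (\<integral>\<^sup>+x. ?F x \<partial>gauss_prod h {..<b + l})"
      by (rule nn_integral_increments[OF BM h _ F]) simp
    also have "\<dots> \<le> ennreal (2 * exp (18 * \<theta>\<^sup>2 * c\<^sup>2 * h * real l))"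
    proof -
      have 1: "(\<integral>\<^sup>+x. 1 \<partial>gauss_prod h {..<b}) = 1"
        using prob_space.emeasure_space_1[OF prob_space_gauss_prod[OF h]] by simp
      have "(\<integral>\<^sup>+x. 1 * ?F x \<partial>gauss_prod h {..<b + l})
         \<le> ennreal (2 * exp (18 * \<theta>\<^sup>2 * c\<^sup>2 * h * real l)) * (\<integral>\<^sup>+x. 1 \<partial>gauss_prod h {..<b})"
        by (rule block_mgf_past[OF h m \<phi> mb borel_measurable_const borel_measurable_const refl])
      then show ?thesis unfolding 1 mult_1_left mult_1_right .
    qed
    finally show "(\<integral>\<^sup>+\<omega>. ennreal (exp (\<theta> * (\<Sum>i<l. pstep W \<phi> h m (b + i) \<omega>))) \<partial>M)
        \<le> ennreal (2 * exp (18 * c\<^sup>2 * (h * real l) * \<theta>\<^sup>2))"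
      by (simp add: mult_ac)
  qed (use c h l a in auto)
  then show ?thesis by (simp add: mult.assoc)
qed

lemma multi_block_tail:
  assumes BM: "brownian_motion M W" and h: "h > 0"
    and m: "case_prod \<phi> \<in> borel_measurable (borel \<Otimes>\<^sub>M borel)"
    and \<phi>: "\<And>z u. \<bar>\<phi> z u\<bar> \<le> c" and c: "c > 0" and L: "L > 0" and a: "a > 0"
    and T: "T > 0" "h * real (K * L) \<le> T"
  shows "measure M {\<omega> \<in> space M. \<bar>\<Sum>i<K * L. pstep W \<phi> h (i div L * L) i \<omega>\<bar> > a}
      \<le> 2 * 2 ^ K * exp (- (a\<^sup>2 / (72 * c\<^sup>2 * T)))"
proof -
  interpret prob_space M by (rule brownian_motionD[OF BM])
  have lt: "i div L * L \<le> K * L" if "i < K * L" for i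
    using that by (meson div_times_less_eq_dividend less_imp_le order_trans)
  have "prob {\<omega> \<in> space M. \<bar>\<Sum>i<K * L. pstep W \<phi> h (i div L * L) i \<omega>\<bar> > a}
      \<le> 2 * 2 ^ K * exp (- (a\<^sup>2 / (4 * (18 * c\<^sup>2 * T))))"
  proof (rule two_sided_chernoff)
    show "(\<lambda>\<omega>. \<Sum>i<K * L. pstep W \<phi> h (i div L * L) i \<omega>) \<in> borel_measurable M"
      by (intro borel_measurable_sum measurable_pstep[OF BM h m])
    fix \<theta>
    let ?F = "\<lambda>x. ennreal (exp (\<theta> * (\<Sum>i<K * L. cstep \<phi> (i div L * L) i x)))"
    have "(\<lambda>x. \<Sum>i<K * L. cstep \<phi> (i div L * L) i x) \<in> borel_measurable (gauss_prod h {..<K * L})"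
      using lt by (intro borel_measurable_sum measurable_cstep m) auto
    then have F: "?F \<in> borel_measurable (gauss_prod h {..<K * L})" by measurable
    have "(\<integral>\<^sup>+\<omega>. ennreal (exp (\<theta> * (\<Sum>i<K * L. pstep W \<phi> h (i div L * L) i \<omega>))) \<partial>M)
      = (\<integral>\<^sup>+\<omega>. ?F (increments W h {..<K * L} \<omega>) \<partial>M)"
      using lt by (intro nn_integral_cong) (simp add: cstep_increments[OF BM])
    also have "\<dots> = (\<integral>\<^sup>+x. ?F x \<partial>gauss_prod h {..<K * L})"
      by (rule nn_integral_increments[OF BM h _ F]) simp
    also have "\<dots> \<le> ennreal (2 ^ K * exp (18 * \<theta>\<^sup>2 * c\<^sup>2 * h * real (K * L)))"
      by (rule multi_block_mgf[OF h m \<phi> L])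
    also have "\<dots> \<le> ennreal (2 ^ K * exp (18 * c\<^sup>2 * T * \<theta>\<^sup>2))"
    proof -
      have "(18 * \<theta>\<^sup>2 * c\<^sup>2) * (h * real (K * L)) \<le> (18 * \<theta>\<^sup>2 * c\<^sup>2) * T"
        using T by (intro mult_left_mono) auto
      then show ?thesis by (intro ennreal_leI mult_left_mono) (simp_all add: mult_ac)
    qed
    finally show "(\<integral>\<^sup>+\<omega>. ennreal (exp (\<theta> * (\<Sum>i<K * L. pstep W \<phi> h (i div L * L) i \<omega>))) \<partial>M)
        \<le> ennreal (2 ^ K * exp (18 * c\<^sup>2 * T * \<theta>\<^sup>2))" .
  qed (use c T a in auto)
  then show ?thesis by (simp add: mult.assoc)
qed

lemma brownian_grid_maximal:
  assumes BM: "brownian_motion M W" and h: "h > 0" and l: "l > 0" and q: "q > 0"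
  shows "measure M {\<omega> \<in> space M. \<exists>i\<le>l. q \<le> \<bar>W (real (b + i) * h) \<omega> - W (real b * h) \<omega>\<bar>}
     \<le> 2 * exp (- (q\<^sup>2 / (2 * (h * real l))))"
proof -
  interpret prob_space M by (rule brownian_motionD[OF BM])
  define u where "u = h * real l"
  have u: "u > 0" using h l by (simp add: u_def)
  let ?D = "\<lambda>i \<omega>. W (real (b + i) * h) \<omega> - W (real b * h) \<omega>"
  have W: "W t \<in> borel_measurable M" if "t \<ge> 0" for t
    using brownian_motionD(2)[OF BM that] .
  have D [measurable]: "?D i \<in> borel_measurable M" for i
    using h by (intro borel_measurable_diff W) auto
  have meas: "{\<omega> \<in> space M. \<exists>i\<le>l. r \<le> a * ?D i \<omega>} \<in> events" for r a
    by measurable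
  have one: "prob {\<omega> \<in> space M. \<exists>i\<le>l. r \<le> a * ?D i \<omega>} \<le> exp (a\<^sup>2 * h * real l / 2 - r)" for r a
  proof -
    let ?P = "gauss_prod h {b..<b + l}"
    let ?A = "{x \<in> space ?P. \<exists>i\<le>l. r \<le> a * sum x {b..<b + i}}"
    have "Measurable.pred ?P (\<lambda>x. \<exists>i\<in>{..l}. r \<le> a * sum x {b..<b + i})"
    proof (rule pred_intros_finite)
      fix i assume "i \<in> {..l}"
      then have [measurable]: "(\<lambda>x. sum x {b..<b + i}) \<in> borel_measurable ?P"
        by (intro measurable_gauss_prod_sum) auto
      show "Measurable.pred ?P (\<lambda>x. r \<le> a * sum x {b..<b + i})" by measurable
    qed simp
    then have A: "?A \<in> sets ?P" by (simp add: pred_def)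
    have "measure ?P ?A = measure (distr M ?P (increments W h {b..<b + l})) ?A"
      by (simp add: distr_increments[OF BM h])
    also have "\<dots> = prob (increments W h {b..<b + l} -` ?A \<inter> space M)"
      by (rule measure_distr[OF measurable_increments[OF BM h] A])
    also have "increments W h {b..<b + l} -` ?A \<inter> space M = {\<omega> \<in> space M. \<exists>i\<le>l. r \<le> a * ?D i \<omega>}"
      using measurable_space[OF measurable_increments[OF BM h, of "{b..<b + l}"]]
      by (auto simp: sum_increments)
    finally show ?thesis
      using gauss_walk_maximal[OF h, of b l r a] by simp
  qed
  \<comment> \<open>With \<open>u\<close> the variance over the whole window, slope
    \<open>q / u\<close> and level \<open>q\<^sup>2 / u\<close> optimise the one-sided bound; the
    two signs of the slope cover the absolute value.\<close>
  have sub: "{\<omega> \<in> space M. \<exists>i\<le>l. q \<le> \<bar>?D i \<omega>\<bar>} \<subseteq>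
      {\<omega> \<in> space M. \<exists>i\<le>l. q\<^sup>2 / u \<le> (q / u) * ?D i \<omega>} \<union> {\<omega> \<in> space M. \<exists>i\<le>l. q\<^sup>2 / u \<le> (- (q / u)) * ?D i \<omega>}"
  proof safe
    fix \<omega> i assume i: "i \<le> l" "q \<le> \<bar>?D i \<omega>\<bar>" and n: "\<not> (\<exists>i\<le>l. q\<^sup>2 / u \<le> - (q / u) * ?D i \<omega>)"
    have "(q / u) * q \<le> (q / u) * \<bar>?D i \<omega>\<bar>"
      using i(2) q u by (intro mult_left_mono) auto
    then have "q\<^sup>2 / u \<le> (q / u) * \<bar>?D i \<omega>\<bar>" by (simp add: power2_eq_square)
    then have "q\<^sup>2 / u \<le> (q / u) * ?D i \<omega> \<or> q\<^sup>2 / u \<le> - (q / u) * ?D i \<omega>"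
      by (cases "?D i \<omega> \<ge> 0") (simp_all only: abs_of_nonneg abs_of_neg not_le mult_minus_left mult_minus_right simp_thms)
    with n i(1) show "\<exists>i\<le>l. q\<^sup>2 / u \<le> (q / u) * ?D i \<omega>" by blast
  qed
  have e: "(q / u)\<^sup>2 * h * real l / 2 - q\<^sup>2 / u = - (q\<^sup>2 / (2 * u))"
  proof -
    have "(q / u)\<^sup>2 * h * real l = (q / u)\<^sup>2 * u" by (simp add: u_def)
    then show ?thesis using u by (simp add: power2_eq_square field_simps)
  qed
  have "prob {\<omega> \<in> space M. \<exists>i\<le>l. q \<le> \<bar>?D i \<omega>\<bar>} \<le>
    prob ({\<omega> \<in> space M. \<exists>i\<le>l. q\<^sup>2 / u \<le> (q / u) * ?D i \<omega>} \<union> {\<omega> \<in> space M. \<exists>i\<le>l. q\<^sup>2 / u \<le> (- (q / u)) * ?D i \<omega>})"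
    by (intro finite_measure_mono sub sets.Un meas)
  also have "\<dots> \<le> prob {\<omega> \<in> space M. \<exists>i\<le>l. q\<^sup>2 / u \<le> (q / u) * ?D i \<omega>} +
      prob {\<omega> \<in> space M. \<exists>i\<le>l. q\<^sup>2 / u \<le> (- (q / u)) * ?D i \<omega>}"
    by (intro measure_Un_le meas)
  also have "\<dots> \<le> exp (- (q\<^sup>2 / (2 * u))) + exp (- (q\<^sup>2 / (2 * u)))"
    using one[of "q\<^sup>2 / u" "q / u"] one[of "q\<^sup>2 / u" "- (q / u)"]
    by (intro add_mono) (simp_all only: power2_minus e)
  finally show ?thesis by (simp add: u_def)
qed

subsection \<open>Limits of grid sums and the good event\<close>

lemma partition_of_nonneg:
  assumes "partition_of p N t" "i \<le> N"
  shows "p i \<ge> 0"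
  using assms(2)
proof (induction i)
  case 0
  then show ?case using assms(1) by (simp add: partition_of_def)
next
  case (Suc i)
  then have "p i < p (Suc i)" using assms(1) by (simp add: partition_of_def)
  with Suc show ?case by simp
qed

lemma partition_of_0:
  assumes "partition_of p N 0"
  shows "N = 0"
proof (rule ccontr)
  assume "N \<noteq> 0"
  then have "p (N - 1) < p N" "p (N - 1) \<ge> 0"
    using assms partition_of_nonneg[OF assms, of "N - 1"]
    by (auto simp: partition_of_def dest: spec[of _ "N - 1"])
  then show False using assms by (simp add: partition_of_def)
qed

text \<open>Partitions increase strictly, so the only one of \<open>[0, 0]\<close> has no intervals.
  This lets \<open>coarse_tail\<close> treat \<open>Q\<close> itself as an increment from time
  0.\<close>

lemma is_qcov_0: "is_qcov M X Y 0 (\<lambda>_. 0)"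
  unfolding is_qcov_def
  by (auto dest!: partition_of_0 simp: cov_sum_def intro!: exI[of _ 1])

lemma measurable_cov_sum:
  assumes "\<And>u. u \<ge> 0 \<Longrightarrow> X u \<in> borel_measurable M" "\<And>u. u \<ge> 0 \<Longrightarrow> Y u \<in> borel_measurable M"
    and "partition_of p N t"
  shows "cov_sum X Y p N \<in> borel_measurable M"
  unfolding cov_sum_def
  by (intro borel_measurable_sum borel_measurable_times borel_measurable_diff assms(1,2)
      partition_of_nonneg[OF assms(3)]) auto

text \<open>Carries a bound that is uniform over grids to the limits in probability:
  \<open>a\<close> is split as \<open>a / 2 + a / 4 + a / 4\<close>, the quarters being
  approximation errors of arbitrarily small probability. One sequence \<open>p\<close> with two
  lengths serves both times, so that in the applications the difference of the sums is a sum over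
  the interval between them.\<close>

lemma (in prob_space) qcov_increment_tail:
  assumes X: "\<And>u. u \<ge> 0 \<Longrightarrow> X u \<in> borel_measurable M" and Y: "\<And>u. u \<ge> 0 \<Longrightarrow> Y u \<in> borel_measurable M"
    and qs: "is_qcov M X Y s Cs" and qt: "is_qcov M X Y t Ct" and a: "a > 0"
    and G: "G \<in> events"
    and approx: "\<And>d. d > 0 \<Longrightarrow> \<exists>p N N'. partition_of p N s \<and> partition_of p N' t \<and>
        (\<forall>i<N. p (Suc i) - p i < d) \<and> (\<forall>i<N'. p (Suc i) - p i < d) \<and>
        prob {\<omega> \<in> G. \<bar>cov_sum X Y p N' \<omega> - cov_sum X Y p N \<omega>\<bar> > a / 2} \<le> \<beta>"
  shows "prob {\<omega> \<in> G. \<bar>Ct \<omega> - Cs \<omega>\<bar> > a} \<le> \<beta>"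
proof (rule field_le_epsilon)
  fix \<eta> :: real assume \<eta>: "\<eta> > 0"
  have a4: "a / 4 > 0" "\<eta> / 2 > 0" using a \<eta> by auto
  have Cm [measurable]: "Cs \<in> borel_measurable M" "Ct \<in> borel_measurable M"
    using qs qt unfolding is_qcov_def by auto
  obtain d1 where d1: "d1 > 0" "\<And>m p. partition_of p m s \<and> (\<forall>i<m. p (Suc i) - p i < d1) \<Longrightarrow>
        prob {\<omega> \<in> space M. \<bar>cov_sum X Y p m \<omega> - Cs \<omega>\<bar> > a / 4} < \<eta> / 2"
    using conjunct2[OF qs[unfolded is_qcov_def], rule_format, OF a4] by blast
  obtain d2 where d2: "d2 > 0" "\<And>m p. partition_of p m t \<and> (\<forall>i<m. p (Suc i) - p i < d2) \<Longrightarrow>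
        prob {\<omega> \<in> space M. \<bar>cov_sum X Y p m \<omega> - Ct \<omega>\<bar> > a / 4} < \<eta> / 2"
    using conjunct2[OF qt[unfolded is_qcov_def], rule_format, OF a4] by blast
  obtain p N N' where p: "partition_of p N s" "partition_of p N' t"
      "\<forall>i<N. p (Suc i) - p i < min d1 d2" "\<forall>i<N'. p (Suc i) - p i < min d1 d2"
      "prob {\<omega> \<in> G. \<bar>cov_sum X Y p N' \<omega> - cov_sum X Y p N \<omega>\<bar> > a / 2} \<le> \<beta>"
  proof -
    have "min d1 d2 > 0" using d1(1) d2(1) by simp
    from approx[OF this] that show ?thesis by blast
  qed
  note [measurable] = measurable_cov_sum[OF X Y p(1)] measurable_cov_sum[OF X Y p(2)] G
  let ?A1 = "{\<omega> \<in> space M. \<bar>cov_sum X Y p N \<omega> - Cs \<omega>\<bar> > a / 4}"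
  let ?A2 = "{\<omega> \<in> space M. \<bar>cov_sum X Y p N' \<omega> - Ct \<omega>\<bar> > a / 4}"
  let ?A3 = "{\<omega> \<in> G. \<bar>cov_sum X Y p N' \<omega> - cov_sum X Y p N \<omega>\<bar> > a / 2}"
  have A3: "?A3 = {\<omega> \<in> space M. \<omega> \<in> G \<and> \<bar>cov_sum X Y p N' \<omega> - cov_sum X Y p N \<omega>\<bar> > a / 2}"
    using sets.sets_into_space[OF G] by auto
  have ev: "?A1 \<in> events" "?A2 \<in> events" "?A3 \<in> events"
    unfolding A3 by measurable
  have "{\<omega> \<in> G. \<bar>Ct \<omega> - Cs \<omega>\<bar> > a} \<subseteq> ?A3 \<union> (?A1 \<union> ?A2)"
  proof
    fix \<omega> assume \<omega>: "\<omega> \<in> {\<omega> \<in> G. \<bar>Ct \<omega> - Cs \<omega>\<bar> > a}"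
    then have "\<omega> \<in> space M" using sets.sets_into_space[OF G] by auto
    moreover have "\<bar>cov_sum X Y p N' \<omega> - cov_sum X Y p N \<omega>\<bar> > a / 2 \<or>
       \<bar>cov_sum X Y p N \<omega> - Cs \<omega>\<bar> > a / 4 \<or> \<bar>cov_sum X Y p N' \<omega> - Ct \<omega>\<bar> > a / 4"
      using \<omega> by (simp add: abs_if split: if_splits; linarith)
    ultimately show "\<omega> \<in> ?A3 \<union> (?A1 \<union> ?A2)" using \<omega> by auto
  qed
  then have "prob {\<omega> \<in> G. \<bar>Ct \<omega> - Cs \<omega>\<bar> > a} \<le> prob (?A3 \<union> (?A1 \<union> ?A2))"
    by (intro finite_measure_mono) (auto intro!: ev)
  also have "\<dots> \<le> prob ?A3 + (prob ?A1 + prob ?A2)"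
    by (intro order_trans[OF measure_Un_le] add_left_mono measure_Un_le sets.Un ev)
  also have "\<dots> \<le> \<beta> + (\<eta> / 2 + \<eta> / 2)"
    using p(3,4) by (intro add_mono p(5) less_imp_le[OF d1(2)] less_imp_le[OF d2(2)] conjI p(1,2)) auto
  finally show "prob {\<omega> \<in> G. \<bar>Ct \<omega> - Cs \<omega>\<bar> > a} \<le> \<beta> + \<eta>" by simp
qed

text \<open>Only grid points of level \<open>m\<close> are tested, which makes the condition a
  finite one. The index \<open>i = 2 ^ m\<close>, the right end of the block, is included.\<close>

definition good_at :: "(real \<Rightarrow> 'a \<Rightarrow> real) \<Rightarrow> nat \<Rightarrow> real \<Rightarrow> real \<Rightarrow> nat \<Rightarrow> 'a \<Rightarrow> bool" where
  "good_at W n \<delta> q m \<omega> \<longleftrightarrow> (\<forall>k<n. \<forall>i\<le>2 ^ m.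
     \<bar>W (real (k * 2 ^ m + i) * (\<delta> / 2 ^ m)) \<omega> - W (real (k * 2 ^ m) * (\<delta> / 2 ^ m)) \<omega>\<bar> < q)"

lemma measurable_good_at:
  assumes BM: "brownian_motion M W" and \<delta>: "\<delta> > 0"
  shows "{\<omega> \<in> space M. \<not> good_at W n \<delta> q m \<omega>} \<in> sets M"
proof -
  have [measurable]: "W (real j * (\<delta> / 2 ^ m)) \<in> borel_measurable M" for j
    using \<delta> by (simp add: brownian_motionD(2)[OF BM])
  show ?thesis unfolding good_at_def by measurable
qed

text \<open>The maximal inequality sees only the block length \<open>\<delta>\<close> and not the
  mesh, so every level has the same bound. The grids are nested, hence the bad events increase with
  \<open>m\<close> and their union obeys this bound too.\<close>

lemma good_event_prob:
  assumes BM: "brownian_motion M W" and \<delta>: "\<delta> > 0" and q: "q > 0"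
  shows "measure M {\<omega> \<in> space M. \<exists>m. \<not> good_at W n \<delta> q m \<omega>} \<le> real n * (2 * exp (- (q\<^sup>2 / (2 * \<delta>))))"
proof -
  interpret prob_space M by (rule brownian_motionD[OF BM])
  let ?B = "\<lambda>m. {\<omega> \<in> space M. \<not> good_at W n \<delta> q m \<omega>}"
  let ?D = "\<lambda>m k. {\<omega> \<in> space M. \<exists>i\<le>2 ^ m. q \<le>
     \<bar>W (real (k * 2 ^ m + i) * (\<delta> / 2 ^ m)) \<omega> - W (real (k * 2 ^ m) * (\<delta> / 2 ^ m)) \<omega>\<bar>}"
  have ev: "?B m \<in> events" for m by (rule measurable_good_at[OF BM \<delta>])
  have evD: "?D m k \<in> events" for m k
  proof -
    have [measurable]: "W (real j * (\<delta> / 2 ^ m)) \<in> borel_measurable M" for j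
      using \<delta> by (simp add: brownian_motionD(2)[OF BM])
    show ?thesis by measurable
  qed
  have bound: "prob (?B m) \<le> real n * (2 * exp (- (q\<^sup>2 / (2 * \<delta>))))" for m
  proof -
    have eq: "?B m = (\<Union>k\<in>{..<n}. ?D m k)"
      unfolding good_at_def not_all not_imp not_less by blast
    have "prob (?B m) \<le> (\<Sum>k<n. prob (?D m k))"
      unfolding eq by (rule measure_UNION_le) (simp, rule evD)
    also have "\<dots> \<le> (\<Sum>k<n. 2 * exp (- (q\<^sup>2 / (2 * ((\<delta> / 2 ^ m) * real (2 ^ m))))))"
      using \<delta> q by (intro sum_mono brownian_grid_maximal[OF BM]) auto
    finally show ?thesis by simp
  qed
  have step: "?B m \<subseteq> ?B (Suc m)" for m
  proof safe
    fix \<omega> assume g: "good_at W n \<delta> q (Suc m) \<omega>" and "\<not> good_at W n \<delta> q m \<omega>"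
    then obtain k i where ki: "k < n" "i \<le> 2 ^ m"
      "\<not> \<bar>W (real (k * 2 ^ m + i) * (\<delta> / 2 ^ m)) \<omega> - W (real (k * 2 ^ m) * (\<delta> / 2 ^ m)) \<omega>\<bar> < q"
      unfolding good_at_def by auto
    have "real (k * 2 ^ Suc m + 2 * i) * (\<delta> / 2 ^ Suc m) = real (k * 2 ^ m + i) * (\<delta> / 2 ^ m)"
      "real (k * 2 ^ Suc m) * (\<delta> / 2 ^ Suc m) = real (k * 2 ^ m) * (\<delta> / 2 ^ m)"
      by (simp_all add: field_simps)
    moreover have "2 * i \<le> 2 ^ Suc m" using ki(2) by simp
    ultimately show False
      using g ki(1,3) unfolding good_at_def by metis
  qed
  have "(\<lambda>m. prob (?B m)) \<longlonglongrightarrow> prob (\<Union>m. ?B m)"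
    using ev step by (intro finite_Lim_measure_incseq) (auto intro!: incseq_SucI)
  then have "prob (\<Union>m. ?B m) \<le> real n * (2 * exp (- (q\<^sup>2 / (2 * \<delta>))))"
    by (rule LIMSEQ_le_const2) (use bound in auto)
  moreover have "(\<Union>m. ?B m) = {\<omega> \<in> space M. \<exists>m. \<not> good_at W n \<delta> q m \<omega>}" by auto
  ultimately show ?thesis by simp
qed

definition clipped :: "(real \<Rightarrow> real) \<Rightarrow> real \<Rightarrow> real \<Rightarrow> real \<Rightarrow> real \<Rightarrow> real" where
  "clipped f \<epsilon> c z u = max (- c) (min c (f (\<epsilon> * u) - f (\<epsilon> * z)))"

lemma clipped_bound: "c > 0 \<Longrightarrow> \<bar>clipped f \<epsilon> c z u\<bar> \<le> c"
  by (auto simp: clipped_def)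

lemma measurable_clipped:
  assumes [measurable]: "f \<in> borel_measurable borel"
  shows "case_prod (clipped f \<epsilon> c) \<in> borel_measurable (borel \<Otimes>\<^sub>M borel)"
  unfolding clipped_def by measurable

text \<open>Both ends of the step lie in the closed block, where \<open>good_at\<close> keeps the
  path within \<open>q\<close> of the left end. The clipping is therefore inactive, and the
  subtracted value of \<open>f\<close> cancels in the difference.\<close>

lemma cov_term_good:
  assumes g: "good_at W n \<delta> q m \<omega>" and \<epsilon>: "\<epsilon> > 0" and i: "i < n * 2 ^ m"
    and f: "\<And>x y. \<bar>x - y\<bar> < \<epsilon> * q \<Longrightarrow> \<bar>f x - f y\<bar> \<le> c"
  shows "(f (\<epsilon> * W (real (Suc i) * (\<delta> / 2 ^ m)) \<omega>) - f (\<epsilon> * W (real i * (\<delta> / 2 ^ m)) \<omega>)) *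
     (\<epsilon> * W (real (Suc i) * (\<delta> / 2 ^ m)) \<omega> - \<epsilon> * W (real i * (\<delta> / 2 ^ m)) \<omega>)
    = \<epsilon> * pstep W (clipped f \<epsilon> c) (\<delta> / 2 ^ m) (i div 2 ^ m * 2 ^ m) i \<omega>"
proof -
  let ?W = "\<lambda>j. W (real j * (\<delta> / 2 ^ m)) \<omega>"
  let ?k = "i div 2 ^ m"
  let ?j = "i mod 2 ^ m"
  have k: "?k < n" using i by (simp add: less_mult_imp_div_less)
  have j: "?j < 2 ^ m" by simp
  have ij: "i = ?k * 2 ^ m + ?j" by (simp only: div_mult_mod_eq)
  have cl: "clipped f \<epsilon> c (?W (?k * 2 ^ m)) (?W (?k * 2 ^ m + l)) = f (\<epsilon> * ?W (?k * 2 ^ m + l)) - f (\<epsilon> * ?W (?k * 2 ^ m))"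
    if "l \<le> 2 ^ m" for l
  proof -
    have "\<bar>?W (?k * 2 ^ m + l) - ?W (?k * 2 ^ m)\<bar> < q"
      using g k that unfolding good_at_def by blast
    then have "\<bar>\<epsilon> * ?W (?k * 2 ^ m + l) - \<epsilon> * ?W (?k * 2 ^ m)\<bar> < \<epsilon> * q"
      using \<epsilon> by (simp add: right_diff_distrib[symmetric] abs_mult)
    from f[OF this] show ?thesis by (auto simp: clipped_def)
  qed
  have "clipped f \<epsilon> c (?W (?k * 2 ^ m)) (?W i) = f (\<epsilon> * ?W i) - f (\<epsilon> * ?W (?k * 2 ^ m))"
    using cl[of ?j] j unfolding ij[symmetric] by simp
  moreover have "clipped f \<epsilon> c (?W (?k * 2 ^ m)) (?W (Suc i)) = f (\<epsilon> * ?W (Suc i)) - f (\<epsilon> * ?W (?k * 2 ^ m))"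
  proof -
    \<comment> \<open>For the last step of a block the offset \<open>Suc ?j\<close> equals
      \<open>2 ^ m\<close>: the right end still uses the reference point of this block and not of
      the next one.\<close>
    have "?k * 2 ^ m + Suc ?j = Suc i" using ij by linarith
    then show ?thesis using cl[of "Suc ?j"] j by (simp only: Suc_le_eq)
  qed
  ultimately show ?thesis
    unfolding pstep_def by (simp only:) (simp add: algebra_simps)
qed

subsection \<open>Tails of the covariation process\<close>

text \<open>Here \<open>\<epsilon>\<close> is fixed. The constant \<open>c\<close> is any positive
  majorant of the oscillation at scale \<open>\<epsilon> * q\<close>, not the oscillation itself, so
  that a vanishing oscillation can be treated by letting \<open>c\<close> tend to 0.\<close>

locale brownian_qcov =
  fixes M :: "'a measure" and W :: "real \<Rightarrow> 'a \<Rightarrow> real" and f :: "real \<Rightarrow> real"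
    and T :: real and n :: nat and \<epsilon> c q :: real and Q :: "real \<Rightarrow> 'a \<Rightarrow> real"
  assumes BM: "brownian_motion M W" and T: "T > 0" and n: "n > 0"
    and \<epsilon>: "\<epsilon> > 0" and c: "c > 0" and q: "q > 0"
    and f [measurable]: "f \<in> borel_measurable borel"
    and osc: "\<And>x y. \<bar>x - y\<bar> < \<epsilon> * q \<Longrightarrow> \<bar>f x - f y\<bar> \<le> c"
    and Q: "\<And>t. t \<in> {0..T} \<Longrightarrow> is_qcov M (\<lambda>s \<omega>. f (\<epsilon> * W s \<omega>)) (\<lambda>s \<omega>. \<epsilon> * W s \<omega>) t (Q t)"
begin

sublocale prob_space M by (rule brownian_motionD[OF BM])

definition \<delta> :: real where "\<delta> = T / real n"

lemma \<delta>: "\<delta> > 0" "real n * \<delta> = T"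
  using T n by (auto simp: \<delta>_def)

definition good :: "'a set" where
  "good = {\<omega> \<in> space M. \<forall>m. good_at W n \<delta> q m \<omega>}"

lemma good_events: "good \<in> events"
proof -
  have "good = space M - (\<Union>m. {\<omega> \<in> space M. \<not> good_at W n \<delta> q m \<omega>})"
    by (auto simp: good_def)
  then show ?thesis
    using measurable_good_at[OF BM \<delta>(1)] by auto
qed

lemma path_measurable:
  assumes "u \<ge> 0"
  shows "(\<lambda>\<omega>. f (\<epsilon> * W u \<omega>)) \<in> borel_measurable M" "(\<lambda>\<omega>. \<epsilon> * W u \<omega>) \<in> borel_measurable M"
  using brownian_motionD(2)[OF BM assms] by measurable

abbreviation grid_step :: "nat \<Rightarrow> nat \<Rightarrow> 'a \<Rightarrow> real" where
  "grid_step m i \<equiv> pstep W (clipped f \<epsilon> c) (\<delta> / 2 ^ m) (i div 2 ^ m * 2 ^ m) i"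

abbreviation grid_cov :: "nat \<Rightarrow> nat \<Rightarrow> 'a \<Rightarrow> real" where
  "grid_cov m N \<equiv> cov_sum (\<lambda>s \<omega>. f (\<epsilon> * W s \<omega>)) (\<lambda>s \<omega>. \<epsilon> * W s \<omega>) (\<lambda>i. real i * (\<delta> / 2 ^ m)) N"

lemma grid_cov_diff:
  assumes "\<omega> \<in> good" "N + l \<le> n * 2 ^ m"
  shows "grid_cov m (N + l) \<omega> - grid_cov m N \<omega> = \<epsilon> * (\<Sum>i<l. grid_step m (N + i) \<omega>)"
proof -
  have "good_at W n \<delta> q m \<omega>" using assms(1) by (simp add: good_def)
  note t = cov_term_good[OF this \<epsilon> _ osc]
  show ?thesis
    unfolding cov_sum_def sum_lessThan_add sum_distrib_left add_diff_cancel_left'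
    using assms(2) by (intro sum.cong refl t) auto
qed

lemma grid_partition: "partition_of (\<lambda>i. real i * (\<delta> / 2 ^ m)) N (real N * (\<delta> / 2 ^ m))"
  using \<delta>(1) by (auto simp: partition_of_def divide_strict_right_mono)

lemma fine_grid_exists:
  assumes "d > 0"
  obtains r where "\<delta> / 2 ^ (m + r) < d"
proof -
  obtain r where r: "\<delta> / d < 2 ^ r" using real_arch_pow[of 2 "\<delta> / d"] by auto
  also have "(2::real) ^ r \<le> 2 ^ (m + r)" by (simp add: power_increasing)
  finally have "\<delta> / 2 ^ (m + r) < d" using assms by (simp add: field_simps)
  then show ?thesis by (rule that)
qed

lemma grid_increment_prob:
  assumes "N + l \<le> n * 2 ^ m" and g: "g > 0"
  shows "prob {\<omega> \<in> good. \<bar>grid_cov m (N + l) \<omega> - grid_cov m N \<omega>\<bar> > \<epsilon> * g / 2}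
    \<le> prob {\<omega> \<in> space M. \<bar>\<Sum>i<l. grid_step m (N + i) \<omega>\<bar> > g / 2}"
proof (rule finite_measure_mono)
  show "{\<omega> \<in> good. \<bar>grid_cov m (N + l) \<omega> - grid_cov m N \<omega>\<bar> > \<epsilon> * g / 2}
    \<subseteq> {\<omega> \<in> space M. \<bar>\<Sum>i<l. grid_step m (N + i) \<omega>\<bar> > g / 2}"
  proof safe
    fix \<omega> assume \<omega>: "\<omega> \<in> good" "\<epsilon> * g / 2 < \<bar>grid_cov m (N + l) \<omega> - grid_cov m N \<omega>\<bar>"
    then show "\<omega> \<in> space M" by (simp add: good_def)
    have "\<epsilon> * (g / 2) < \<epsilon> * \<bar>\<Sum>i<l. grid_step m (N + i) \<omega>\<bar>"
      using \<omega>(2) \<epsilon> unfolding grid_cov_diff[OF \<omega>(1) assms(1)] by (simp add: abs_mult)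
    then show "g / 2 < \<bar>\<Sum>i<l. grid_step m (N + i) \<omega>\<bar>"
      using \<epsilon> by (simp only: mult_less_cancel_left_pos)
  qed
  have "(\<lambda>\<omega>. \<Sum>i<l. grid_step m (N + i) \<omega>) \<in> borel_measurable M"
    using \<delta>(1) by (intro borel_measurable_sum measurable_pstep[OF BM] measurable_clipped f) auto
  then show "{\<omega> \<in> space M. \<bar>\<Sum>i<l. grid_step m (N + i) \<omega>\<bar> > g / 2} \<in> events"
    by measurable
qed

text \<open>The sums from 0 to \<open>k \<delta>\<close> run through \<open>k\<close> blocks, hence
  the factor \<open>2 ^ k\<close>. Passing to the limit halves the threshold
  \<open>g\<close>.\<close>

lemma coarse_tail:
  assumes k: "k \<le> n" and g: "g > 0"
  shows "prob {\<omega> \<in> good. \<bar>Q (real k * \<delta>) \<omega>\<bar> > \<epsilon> * g} \<le> 2 * 2 ^ k * exp (- ((g / 2)\<^sup>2 / (72 * c\<^sup>2 * T)))"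
proof -
  have kT: "real k * \<delta> \<in> {0..T}"
    using k \<delta> mult_right_mono[of "real k" "real n" \<delta>] by auto
  have "prob {\<omega> \<in> good. \<bar>Q (real k * \<delta>) \<omega> - 0\<bar> > \<epsilon> * g} \<le> 2 * 2 ^ k * exp (- ((g / 2)\<^sup>2 / (72 * c\<^sup>2 * T)))"
  proof (rule qcov_increment_tail[OF path_measurable is_qcov_0 Q[OF kT] _ good_events])
    show "\<epsilon> * g > 0" using \<epsilon> g by simp
    fix d :: real assume "d > 0"
    then obtain m where m: "\<delta> / 2 ^ (0 + m) < d" by (rule fine_grid_exists)
    let ?p = "\<lambda>i. real i * (\<delta> / 2 ^ m)"
    have p: "partition_of ?p 0 0" "partition_of ?p (k * 2 ^ m) (real k * \<delta>)"
      using grid_partition[of m 0] grid_partition[of m "k * 2 ^ m"] by (simp_all add: field_simps)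
    have d: "?p (Suc i) - ?p i < d" for i using m by (simp add: algebra_simps add_divide_distrib)
    have "prob {\<omega> \<in> good. \<bar>grid_cov m (0 + k * 2 ^ m) \<omega> - grid_cov m 0 \<omega>\<bar> > \<epsilon> * g / 2}
      \<le> prob {\<omega> \<in> space M. \<bar>\<Sum>i<k * 2 ^ m. grid_step m (0 + i) \<omega>\<bar> > g / 2}"
      using k by (intro grid_increment_prob g) simp
    also have "\<dots> \<le> 2 * 2 ^ k * exp (- ((g / 2)\<^sup>2 / (72 * c\<^sup>2 * T)))"
      unfolding add_0
      using kT \<delta>(1) g
      by (intro multi_block_tail[OF BM _ measurable_clipped[OF f] clipped_bound[OF c] c _ _ T])
         (simp_all add: mult.commute)
    finally show "\<exists>p N N'. partition_of p N 0 \<and> partition_of p N' (real k * \<delta>) \<and>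
        (\<forall>i<N. p (Suc i) - p i < d) \<and> (\<forall>i<N'. p (Suc i) - p i < d) \<and>
        prob {\<omega> \<in> good. \<epsilon> * g / 2 < \<bar>cov_sum (\<lambda>s \<omega>. f (\<epsilon> * W s \<omega>)) (\<lambda>s \<omega>. \<epsilon> * W s \<omega>) p N' \<omega> -
           cov_sum (\<lambda>s \<omega>. f (\<epsilon> * W s \<omega>)) (\<lambda>s \<omega>. \<epsilon> * W s \<omega>) p N \<omega>\<bar>}
        \<le> 2 * 2 ^ k * exp (- ((g / 2)\<^sup>2 / (72 * c\<^sup>2 * T)))"
      using p d unfolding add_0 by blast
  qed
  then show ?thesis by simp
qed

lemma dyadic_in_range:
  assumes "j \<le> n * 2 ^ m"
  shows "real j * (\<delta> / 2 ^ m) \<in> {0..T}"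
proof -
  have "real j \<le> real (n * 2 ^ m)" using assms by (simp only: of_nat_le_iff)
  then have "real j * (\<delta> / 2 ^ m) \<le> real (n * 2 ^ m) * (\<delta> / 2 ^ m)"
    using \<delta>(1) by (intro mult_right_mono) auto
  also have "\<dots> = T" using \<delta>(2) by simp
  finally show ?thesis using \<delta>(1) by simp
qed

text \<open>A dyadic interval of level \<open>m\<close> lies inside one block, so a single reference
  point serves all of its refinements: the prefactor stays at 4, and the exponent involves only the
  length of the interval.\<close>

lemma fine_tail:
  assumes j: "j < n * 2 ^ m" and g: "g > 0"
  shows "prob {\<omega> \<in> good. \<bar>Q (real (Suc j) * (\<delta> / 2 ^ m)) \<omega> - Q (real j * (\<delta> / 2 ^ m)) \<omega>\<bar> > \<epsilon> * g}
     \<le> 4 * exp (- ((g / 2)\<^sup>2 / (72 * c\<^sup>2 * (\<delta> / 2 ^ m))))"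
proof -
  have jT: "real j * (\<delta> / 2 ^ m) \<in> {0..T}" "real (Suc j) * (\<delta> / 2 ^ m) \<in> {0..T}"
    using j by (intro dyadic_in_range; simp)+
  show ?thesis
  proof (rule qcov_increment_tail[OF path_measurable Q[OF jT(1)] Q[OF jT(2)] _ good_events])
    show "\<epsilon> * g > 0" using \<epsilon> g by simp
    fix d :: real assume "d > 0"
    then obtain r where r: "\<delta> / 2 ^ (m + r) < d" by (rule fine_grid_exists)
    let ?p = "\<lambda>i. real i * (\<delta> / 2 ^ (m + r))"
    let ?N = "j * 2 ^ r"
    have p: "partition_of ?p ?N (real j * (\<delta> / 2 ^ m))"
        "partition_of ?p (?N + 2 ^ r) (real (Suc j) * (\<delta> / 2 ^ m))"
    proof -
      have "real (i * 2 ^ r) * (\<delta> / 2 ^ (m + r)) = real i * (\<delta> / 2 ^ m)" for i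
        by (simp add: power_add)
      moreover have "?N + 2 ^ r = Suc j * 2 ^ r" by simp
      ultimately show "partition_of ?p ?N (real j * (\<delta> / 2 ^ m))"
          "partition_of ?p (?N + 2 ^ r) (real (Suc j) * (\<delta> / 2 ^ m))"
        using grid_partition[of "m + r" ?N] grid_partition[of "m + r" "Suc j * 2 ^ r"]
        by (simp_all only:)
    qed
    have d: "?p (Suc i) - ?p i < d" for i using r by (simp add: algebra_simps add_divide_distrib)
    have "Suc j * 2 ^ r \<le> n * 2 ^ m * 2 ^ r" using j by (intro mult_right_mono) auto
    then have N: "?N + 2 ^ r \<le> n * 2 ^ (m + r)" by (simp add: power_add mult_ac)
    \<comment> \<open>Every step of the refined grid inside this interval has the block number of
      \<open>j\<close>.\<close>
    have blk: "(?N + i) div 2 ^ (m + r) = j div 2 ^ m" if "i < 2 ^ r" for i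
    proof -
      have "(?N + i) div 2 ^ (m + r) = (?N + i) div 2 ^ r div 2 ^ m"
        unfolding div_mult2_eq[symmetric] by (simp add: power_add mult.commute)
      then show ?thesis using that by simp
    qed
    have le: "j div 2 ^ m * 2 ^ (m + r) \<le> ?N"
    proof -
      have "j div 2 ^ m * 2 ^ m * 2 ^ r \<le> j * 2 ^ r" by (intro mult_right_mono) simp_all
      then show ?thesis by (simp add: power_add mult.assoc)
    qed
    have "prob {\<omega> \<in> good. \<bar>grid_cov (m + r) (?N + 2 ^ r) \<omega> - grid_cov (m + r) ?N \<omega>\<bar> > \<epsilon> * g / 2}
      \<le> prob {\<omega> \<in> space M. \<bar>\<Sum>i<2 ^ r. grid_step (m + r) (?N + i) \<omega>\<bar> > g / 2}"
      by (rule grid_increment_prob[OF N g])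
    also have "\<dots> = prob {\<omega> \<in> space M. \<bar>\<Sum>i<2 ^ r. pstep W (clipped f \<epsilon> c) (\<delta> / 2 ^ (m + r))
         (j div 2 ^ m * 2 ^ (m + r)) (?N + i) \<omega>\<bar> > g / 2}"
      by (simp add: blk)
    also have "\<dots> \<le> 4 * exp (- ((g / 2)\<^sup>2 / (72 * c\<^sup>2 * (\<delta> / 2 ^ (m + r) * real (2 ^ r)))))"
      using \<delta>(1) g by (intro block_tail[OF BM _ measurable_clipped[OF f] clipped_bound[OF c] c le]) auto
    also have "\<delta> / 2 ^ (m + r) * real (2 ^ r) = \<delta> / 2 ^ m"
      by (simp add: power_add)
    finally show "\<exists>p N N'. partition_of p N (real j * (\<delta> / 2 ^ m)) \<and> partition_of p N' (real (Suc j) * (\<delta> / 2 ^ m)) \<and>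
        (\<forall>i<N. p (Suc i) - p i < d) \<and> (\<forall>i<N'. p (Suc i) - p i < d) \<and>
        prob {\<omega> \<in> good. \<epsilon> * g / 2 < \<bar>cov_sum (\<lambda>s \<omega>. f (\<epsilon> * W s \<omega>)) (\<lambda>s \<omega>. \<epsilon> * W s \<omega>) p N' \<omega> -
           cov_sum (\<lambda>s \<omega>. f (\<epsilon> * W s \<omega>)) (\<lambda>s \<omega>. \<epsilon> * W s \<omega>) p N \<omega>\<bar>}
        \<le> 4 * exp (- ((g / 2)\<^sup>2 / (72 * c\<^sup>2 * (\<delta> / 2 ^ m))))"
      using p d by blast
  qed
qed

text \<open>The increments over dyadic intervals of level \<open>m\<close> are allowed to be \<open>g (3/4)\<^sup>m / 4\<close>; these
  thresholds add up to \<open>3 g / 4\<close>, yet shrink more slowly than the standard deviation \<open>2\<^bsup>- m/2\<^esup>\<close>.\<close>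

lemma chaining:
  assumes coarse: "\<And>k. k \<le> n \<Longrightarrow> \<bar>Q (real k * \<delta>) \<omega>\<bar> \<le> \<epsilon> * (g / 4)"
    and fine: "\<And>m j. j < n * 2 ^ Suc m \<Longrightarrow>
      \<bar>Q (real (Suc j) * (\<delta> / 2 ^ Suc m)) \<omega> - Q (real j * (\<delta> / 2 ^ Suc m)) \<omega>\<bar> \<le> \<epsilon> * (g * (3/4) ^ Suc m / 4)"
    and "j \<le> n * 2 ^ m"
  shows "\<bar>Q (real j * (\<delta> / 2 ^ m)) \<omega>\<bar> \<le> \<epsilon> * (g * (1 - (3/4) ^ Suc m))"
  using assms(3)
proof (induction m arbitrary: j)
  case 0
  then show ?case using coarse[of j] by simp
next
  case (Suc m)
  have even_pt: "real (2 * i) * (\<delta> / 2 ^ Suc m) = real i * (\<delta> / 2 ^ m)" for i by simp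
  \<comment> \<open>With \<open>y = (3/4) ^ Suc m\<close> this is
    \<open>1 - y + y / 4 = 1 - (3/4) y\<close>. A point that is new at level \<open>Suc m\<close>
    pays the threshold of that level once, from its left neighbour.\<close>
  have step: "\<epsilon> * (g * (1 - (3/4) ^ Suc m)) + \<epsilon> * (g * (3/4) ^ Suc m / 4) = \<epsilon> * (g * (1 - (3/4) ^ Suc (Suc m)))"
    by (simp add: algebra_simps)
  have pos: "0 \<le> \<epsilon> * (g * (3/4) ^ Suc m / 4)"
    using fine[of 0 m] n by (meson abs_ge_zero order_trans nat_0_less_mult_iff zero_less_numeral zero_less_power)
  show ?case
  proof (cases "even j")
    case True
    then obtain i where i: "j = 2 * i" by auto
    then have "\<bar>Q (real j * (\<delta> / 2 ^ Suc m)) \<omega>\<bar> \<le> \<epsilon> * (g * (1 - (3/4) ^ Suc m))"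
      using Suc.IH[of i] Suc.prems unfolding i even_pt by simp
    then show ?thesis using step pos by linarith
  next
    case False
    then obtain i where i: "j = Suc (2 * i)" using oddE by (metis Suc_eq_plus1)
    have "\<bar>Q (real (2 * i) * (\<delta> / 2 ^ Suc m)) \<omega>\<bar> \<le> \<epsilon> * (g * (1 - (3/4) ^ Suc m))"
      using Suc.IH[of i] Suc.prems unfolding i even_pt by simp
    moreover have "\<bar>Q (real j * (\<delta> / 2 ^ Suc m)) \<omega> - Q (real (2 * i) * (\<delta> / 2 ^ Suc m)) \<omega>\<bar> \<le> \<epsilon> * (g * (3/4) ^ Suc m / 4)"
      using fine[of "2 * i" m] Suc.prems unfolding i by simp
    ultimately show ?thesis using step by linarith
  qed
qed

text \<open>Each time is the limit of the dyadic points just below it, so continuity of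
  \<open>Q\<close> extends the bound to the whole interval.\<close>

lemma sup_le:
  assumes dy: "\<And>j m. j \<le> n * 2 ^ m \<Longrightarrow> \<bar>Q (real j * (\<delta> / 2 ^ m)) \<omega>\<bar> \<le> b"
    and cont: "continuous_on {0..T} (\<lambda>t. Q t \<omega>)"
  shows "(SUP t\<in>{0..T}. \<bar>Q t \<omega>\<bar>) \<le> b"
proof (rule cSUP_least)
  show "{0..T} \<noteq> {}" using T by simp
  fix t assume t: "t \<in> {0..T}"
  define j where "j m = nat \<lfloor>t * 2 ^ m / \<delta>\<rfloor>" for m
  define s where "s m = real (j m) * (\<delta> / 2 ^ m)" for m
  have rj: "real (j m) = of_int \<lfloor>t * 2 ^ m / \<delta>\<rfloor>" for m
    unfolding j_def using t \<delta>(1) by simp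
  have jn: "j m \<le> n * 2 ^ m" for m
  proof -
    have "real (j m) \<le> t * 2 ^ m / \<delta>" unfolding rj by simp
    also have "\<dots> \<le> T * 2 ^ m / \<delta>" using t \<delta>(1) by (intro divide_right_mono mult_right_mono) auto
    also have "\<dots> = real (n * 2 ^ m)" using \<delta> by (simp add: field_simps)
    finally show ?thesis by (simp only: of_nat_le_iff)
  qed
  have lo: "t - \<delta> / 2 ^ m \<le> s m" and up: "s m \<le> t" for m
  proof -
    have "t * 2 ^ m / \<delta> - 1 \<le> real (j m)" unfolding rj by linarith
    then have "(t * 2 ^ m / \<delta> - 1) * (\<delta> / 2 ^ m) \<le> s m"
      unfolding s_def using \<delta>(1) by (intro mult_right_mono) auto
    moreover have "(t * 2 ^ m / \<delta> - 1) * (\<delta> / 2 ^ m) = t - \<delta> / 2 ^ m"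
      using \<delta>(1) by (simp add: left_diff_distrib diff_divide_distrib)
    ultimately show "t - \<delta> / 2 ^ m \<le> s m" by simp
    have "real (j m) \<le> t * 2 ^ m / \<delta>" unfolding rj by simp
    then have "s m \<le> (t * 2 ^ m / \<delta>) * (\<delta> / 2 ^ m)"
      unfolding s_def using \<delta>(1) by (intro mult_right_mono) auto
    then show "s m \<le> t" using \<delta>(1) by simp
  qed
  have "(\<lambda>m. \<delta> * (1 / 2) ^ m) \<longlonglongrightarrow> \<delta> * 0"
    by (intro tendsto_mult tendsto_const LIMSEQ_power_zero) simp
  then have "(\<lambda>m. t - \<delta> / 2 ^ m) \<longlonglongrightarrow> t - \<delta> * 0"
    by (intro tendsto_diff tendsto_const) (simp add: power_divide)
  then have "(\<lambda>m. t - \<delta> / 2 ^ m) \<longlonglongrightarrow> t" by simp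
  then have lim: "s \<longlonglongrightarrow> t"
    by (rule tendsto_sandwich[OF always_eventually always_eventually _ tendsto_const, rotated 2])
       (intro allI lo up)+
  have mem: "s m \<in> {0..T}" for m
    unfolding s_def by (rule dyadic_in_range[OF jn])
  have "(\<lambda>m. Q (s m) \<omega>) \<longlonglongrightarrow> Q t \<omega>"
    by (rule continuous_on_tendsto_compose[OF cont lim t]) (intro always_eventually allI mem)
  then have "(\<lambda>m. \<bar>Q (s m) \<omega>\<bar>) \<longlonglongrightarrow> \<bar>Q t \<omega>\<bar>" by (rule tendsto_rabs)
  then show "\<bar>Q t \<omega>\<bar> \<le> b"
    by (rule LIMSEQ_le_const2) (unfold s_def, intro exI allI impI dy jn)
qed

text \<open>\<open>A\<close> is the Gaussian exponent for the coarse points: their threshold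
  \<open>g / 4\<close> is halved in the passage to the limit, and \<open>64 * 72 = 4608\<close>. One
  half of \<open>A\<close> is kept for the result; the other half, at least \<open>8 n\<close>, pays
  for the factors \<open>2 ^ k\<close> and the number of points. The second summand bounds the
  probability of leaving \<open>good\<close>.\<close>

lemma sup_tail:
  assumes cont: "\<And>\<omega>. \<omega> \<in> space M \<Longrightarrow> continuous_on {0..T} (\<lambda>t. Q t \<omega>)"
    and g: "g > 0" and A: "A = g\<^sup>2 / (4608 * T * c\<^sup>2)" and An: "A \<ge> 16 * real n"
  shows "prob {\<omega> \<in> space M. (SUP t\<in>{0..T}. \<bar>Q t \<omega>\<bar>) / \<epsilon> > g}
     \<le> 2 * exp (- A / 2) + real n * (2 * exp (- (q\<^sup>2 / (2 * \<delta>))))"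
proof -
  let ?a = "\<lambda>m. g * (3/4) ^ Suc m / 4"
  define C where "C k = {\<omega> \<in> good. \<bar>Q (real k * \<delta>) \<omega>\<bar> > \<epsilon> * (g / 4)}" for k
  define F where "F m j = {\<omega> \<in> good. \<bar>Q (real (Suc j) * (\<delta> / 2 ^ Suc m)) \<omega> -
       Q (real j * (\<delta> / 2 ^ Suc m)) \<omega>\<bar> > \<epsilon> * ?a m}" for m j
  define B where "B = {\<omega> \<in> space M. \<exists>m. \<not> good_at W n \<delta> q m \<omega>}"
  have n1: "real n \<ge> 1" using n by simp
  have Qm: "Q t \<in> borel_measurable M" if "t \<in> {0..T}" for t
    using Q[OF that] by (simp add: is_qcov_def)
  have good_int: "{\<omega> \<in> good. P \<omega>} = good \<inter> {\<omega> \<in> space M. P \<omega>}" for P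
    by (auto simp: good_def)
  have Cev: "C k \<in> events" if "k \<le> n" for k
  proof -
    have [measurable]: "Q (real k * \<delta>) \<in> borel_measurable M"
      using dyadic_in_range[of k 0] that by (intro Qm) simp
    show ?thesis unfolding C_def good_int by (intro sets.Int good_events) measurable
  qed
  have Fev: "F m j \<in> events" if "j < n * 2 ^ Suc m" for m j
  proof -
    have [measurable]: "Q (real (Suc j) * (\<delta> / 2 ^ Suc m)) \<in> borel_measurable M"
        "Q (real j * (\<delta> / 2 ^ Suc m)) \<in> borel_measurable M"
      using that by (intro Qm dyadic_in_range; simp)+
    show ?thesis unfolding F_def good_int by (intro sets.Int good_events) measurable
  qed
  have Bev: "B \<in> events"
  proof -
    have "B = space M - good" by (auto simp: B_def good_def)
    then show ?thesis using good_events by auto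
  qed
  define CC where "CC = (\<Union>k\<in>{..n}. C k)"
  define FF where "FF m = (\<Union>j\<in>{..<n * 2 ^ Suc m}. F m j)" for m
  have CCev: "CC \<in> events" unfolding CC_def using Cev by (intro sets.finite_UN) auto
  have FFev: "FF m \<in> events" for m unfolding FF_def using Fev by (intro sets.finite_UN) auto
  have eA: "exp (8 * real n) \<le> exp (A / 2)" using An by simp
  have "prob CC \<le> (\<Sum>k\<le>n. prob (C k))"
    unfolding CC_def using Cev by (intro measure_UNION_le) auto
  also have "\<dots> \<le> (\<Sum>k\<le>n. 2 ^ k * (2 * exp (- A)))"
  proof (intro sum_mono)
    fix k assume "k \<in> {..n}"
    then have "prob (C k) \<le> 2 * 2 ^ k * exp (- ((g / 4 / 2)\<^sup>2 / (72 * c\<^sup>2 * T)))"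
      unfolding C_def using g by (intro coarse_tail) auto
    also have "(g / 4 / 2)\<^sup>2 / (72 * c\<^sup>2 * T) = A"
      unfolding A by (simp add: power_divide mult_ac)
    finally show "prob (C k) \<le> 2 ^ k * (2 * exp (- A))" by simp
  qed
  also have "\<dots> = (\<Sum>k\<le>n. 2 ^ k) * (2 * exp (- A))" by (rule sum_distrib_right[symmetric])
  also have "\<dots> \<le> exp (- A / 2)"
  proof -
    have "(\<Sum>k\<le>n. 2 ^ k) \<le> (2::real) ^ Suc n"
      using sum_gp_strict[of "2::real" "Suc n"] by (simp add: lessThan_Suc_atMost)
    then have "(\<Sum>k\<le>n. 2 ^ k) * 2 \<le> (2::real) ^ (n + 2)" by simp
    also have "(2::real) ^ (n + 2) \<le> exp 1 ^ (n + 2)"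
      using exp_ge_add_one_self[of 1] by (intro power_mono) auto
    also have "\<dots> = exp (real n + 2)" by (subst exp_of_nat_mult[symmetric]) simp
    also have "\<dots> \<le> exp (8 * real n)" using n1 by simp
    also note eA
    finally have "(\<Sum>k\<le>n. 2 ^ k) * 2 * exp (- A) \<le> exp (A / 2) * exp (- A)"
      by (intro mult_right_mono) auto
    also have "\<dots> = exp (- A / 2)" unfolding exp_add[symmetric] by simp
    finally show ?thesis by (simp only: mult.assoc)
  qed
  finally have pC: "prob CC \<le> exp (- A / 2)" .
  have pF: "prob (FF m) \<le> exp (- A / 2) * (1 / 2) ^ Suc m" for m
  proof -
    let ?m = "Suc m"
    have "prob (FF m) \<le> (\<Sum>j<n * 2 ^ ?m. prob (F m j))"
      unfolding FF_def using Fev by (intro measure_UNION_le) auto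
    also have "\<dots> \<le> (\<Sum>j<n * 2 ^ ?m. 4 * exp (- (A / 2) - 8 * real n - 2 * real ?m))"
    proof (intro sum_mono)
      fix j assume "j \<in> {..<n * 2 ^ ?m}"
      then have "prob (F m j) \<le> 4 * exp (- ((?a m / 2)\<^sup>2 / (72 * c\<^sup>2 * (\<delta> / 2 ^ ?m))))"
        unfolding F_def using g by (intro fine_tail) auto
      \<comment> \<open>From one level to the next the squared threshold shrinks by
        \<open>9 / 16\<close> and the length by \<open>1 / 2\<close>, so the exponent grows by
        \<open>9 / 8\<close>. The factor \<open>n\<close> comes from
        \<open>\<delta> = T / n\<close>.\<close>
      also have "(?a m / 2)\<^sup>2 / (72 * c\<^sup>2 * (\<delta> / 2 ^ ?m)) = A * real n * (9 / 8) ^ ?m"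
      proof -
        have s: "((3/4::real) ^ ?m)\<^sup>2 = (9 / 8) ^ ?m / 2 ^ ?m"
        proof -
          have "((3/4::real) ^ ?m)\<^sup>2 = ((9 / 8) / 2) ^ ?m"
            unfolding power2_eq_square power_mult_distrib[symmetric] by simp
          then show ?thesis by (simp only: power_divide)
        qed
        define u v :: real where "u = (9 / 8) ^ ?m" and "v = 2 ^ ?m"
        have v: "v > 0" by (simp add: v_def)
        have "(g * z / 4 / 2)\<^sup>2 = g\<^sup>2 * z\<^sup>2 / 64" for z
          by (simp add: power_divide power_mult_distrib)
        then have "(?a m / 2)\<^sup>2 = g\<^sup>2 * (u / v) / 64"
          unfolding u_def v_def s[symmetric] .
        then show ?thesis
          unfolding A \<delta>_def u_def[symmetric] v_def[symmetric] using T n c v by (simp add: field_simps)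
      qed
      also have "4 * exp (- (A * real n * (9 / 8) ^ ?m)) \<le> 4 * exp (- (A / 2) - 8 * real n - 2 * real ?m)"
      proof -
        have A0: "A \<ge> 16" using An n1 by linarith
        have An1: "A * real n \<ge> A" using A0 n1 mult_left_mono[of 1 "real n" A] by simp
        \<comment> \<open>The linear lower bound suffices: with \<open>A n \<ge> A\<close> and
          \<open>A n \<ge> 16\<close> the exponent at level \<open>?m\<close> is at least
          \<open>A + 2 ?m\<close>, and \<open>A / 2 \<ge> 8 n\<close>.\<close>
        have "(9 / 8 :: real) ^ ?m \<ge> 1 + real ?m * (1 / 8)"
          using Bernoulli_inequality[of "1 / 8" ?m] by simp
        then have "A * real n * (9 / 8) ^ ?m \<ge> A * real n * (1 + real ?m * (1 / 8))"
          using A0 n1 by (intro mult_left_mono) auto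
        moreover have "A * real n * (real ?m * (1 / 8)) \<ge> 16 * (real ?m * (1 / 8))"
          using order_trans[OF A0 An1] by (intro mult_right_mono) simp_all
        ultimately have "A * real n * (9 / 8) ^ ?m \<ge> A / 2 + 8 * real n + 2 * real ?m"
          using An1 An unfolding distrib_left by linarith
        then show ?thesis by simp
      qed
      finally show "prob (F m j) \<le> 4 * exp (- (A / 2) - 8 * real n - 2 * real ?m)" .
    qed
    also have "\<dots> = exp (- A / 2) * (4 * real n * exp (- (8 * real n))) * (2 * exp (- 2)) ^ ?m"
    proof -
      have e: "exp (- (A / 2) - 8 * real n - 2 * real ?m) = exp (- A / 2) * exp (- (8 * real n)) * exp (- 2) ^ ?m"
        unfolding exp_of_nat_mult[symmetric] exp_add[symmetric] by (simp add: algebra_simps)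
      show ?thesis
        unfolding e by (simp add: power_mult_distrib del: power_Suc)
    qed
    \<comment> \<open>\<open>exp (- 8 n)\<close> absorbs the number of blocks, and
      \<open>exp (- 2)\<close> per level absorbs the doubling of points; what remains is a geometric
      series.\<close>
    also have "\<dots> \<le> exp (- A / 2) * 1 * (1 / 2) ^ ?m"
    proof (intro mult_mono power_mono)
      have "4 * real n \<le> exp (8 * real n)"
        using exp_ge_add_one_self[of "8 * real n"] n1 by linarith
      then show "4 * real n * exp (- (8 * real n)) \<le> 1"
        by (simp add: exp_minus field_simps)
      have "exp (2::real) = exp 1 * exp 1" unfolding exp_add[symmetric] by simp
      then have "exp (2::real) \<ge> 2 * 2"
        using exp_ge_add_one_self[of 1] by (simp only:) (intro mult_mono, auto)
      then show "2 * exp (- 2) \<le> (1 / 2 :: real)"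
        by (simp add: exp_minus field_simps)
    qed auto
    finally show ?thesis by simp
  qed
  have sums: "(\<lambda>m. exp (- A / 2) * (1 / 2) ^ Suc m) sums (exp (- A / 2) * 1)"
    by (intro sums_mult power_half_series)
  have summ: "summable (\<lambda>m. prob (FF m))"
    by (rule summable_comparison_test'[OF sums_summable[OF sums], of 0]) (use pF in auto)
  have "prob (\<Union>m. FF m) \<le> (\<Sum>m. prob (FF m))"
    using FFev summ by (intro finite_measure_subadditive_countably) auto
  also have "\<dots> \<le> (\<Sum>m. exp (- A / 2) * (1 / 2) ^ Suc m)"
    by (intro suminf_le pF summ sums_summable[OF sums])
  also have "\<dots> = exp (- A / 2)" using sums_unique[OF sums] by simp
  finally have pFF: "prob (\<Union>m. FF m) \<le> exp (- A / 2)" .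
  have "{\<omega> \<in> space M. (SUP t\<in>{0..T}. \<bar>Q t \<omega>\<bar>) / \<epsilon> > g} \<subseteq> (CC \<union> (\<Union>m. FF m)) \<union> B"
  proof (rule subsetI, rule ccontr)
    fix \<omega> assume \<omega>: "\<omega> \<in> {\<omega> \<in> space M. (SUP t\<in>{0..T}. \<bar>Q t \<omega>\<bar>) / \<epsilon> > g}" "\<omega> \<notin> (CC \<union> (\<Union>m. FF m)) \<union> B"
    then have gd: "\<omega> \<in> good" by (auto simp: B_def good_def)
    have co: "\<bar>Q (real k * \<delta>) \<omega>\<bar> \<le> \<epsilon> * (g / 4)" if "k \<le> n" for k
    proof -
      have "\<omega> \<notin> C k" using \<omega>(2) that by (auto simp: CC_def)
      then show ?thesis using gd by (simp add: C_def not_less)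
    qed
    have fi: "\<bar>Q (real (Suc j) * (\<delta> / 2 ^ Suc m)) \<omega> - Q (real j * (\<delta> / 2 ^ Suc m)) \<omega>\<bar> \<le> \<epsilon> * ?a m"
      if "j < n * 2 ^ Suc m" for m j
    proof -
      have "\<omega> \<notin> F m j" using \<omega>(2) that by (auto simp: FF_def)
      then show ?thesis using gd by (simp only: F_def mem_Collect_eq not_less simp_thms)
    qed
    have "(SUP t\<in>{0..T}. \<bar>Q t \<omega>\<bar>) \<le> \<epsilon> * g"
    proof (rule sup_le)
      fix j m assume jm: "j \<le> n * 2 ^ m"
      have "\<bar>Q (real j * (\<delta> / 2 ^ m)) \<omega>\<bar> \<le> \<epsilon> * (g * (1 - (3/4) ^ Suc m))"
        by (rule chaining) (fact co fi jm)+
      also have "\<dots> \<le> \<epsilon> * (g * 1)"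
        using \<epsilon> g by (intro mult_left_mono) auto
      finally show "\<bar>Q (real j * (\<delta> / 2 ^ m)) \<omega>\<bar> \<le> \<epsilon> * g" by simp
    qed (use cont \<omega>(1) in auto)
    then have "(SUP t\<in>{0..T}. \<bar>Q t \<omega>\<bar>) / \<epsilon> \<le> g" using \<epsilon> by (simp add: field_simps)
    then show False using \<omega>(1) by simp
  qed
  then have "prob {\<omega> \<in> space M. (SUP t\<in>{0..T}. \<bar>Q t \<omega>\<bar>) / \<epsilon> > g} \<le> prob ((CC \<union> (\<Union>m. FF m)) \<union> B)"
    using CCev FFev Bev by (intro finite_measure_mono) auto
  also have "\<dots> \<le> (prob CC + prob (\<Union>m. FF m)) + prob B"
    using CCev FFev Bev
    by (intro order_trans[OF measure_Un_le] add_right_mono measure_Un_le) auto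
  also have "\<dots> \<le> (exp (- A / 2) + exp (- A / 2)) + real n * (2 * exp (- (q\<^sup>2 / (2 * \<delta>))))"
    unfolding B_def by (intro add_mono pC pFF good_event_prob[OF BM \<delta>(1) q])
  finally show ?thesis by simp
qed

end

subsection \<open>The oscillation and the main estimate\<close>

text \<open>Boundedness of \<open>f\<close> ensures that the real-valued \<open>SUP\<close> in
  \<open>osc\<close> is a genuine supremum.\<close>

lemma osc_ge:
  assumes "bounded (range f)" "\<bar>x - y\<bar> < d"
  shows "\<bar>f x - f y\<bar> \<le> osc f d"
proof -
  obtain B where B: "\<And>x. \<bar>f x\<bar> \<le> B"
    using assms(1) unfolding bounded_iff by auto
  have "bdd_above ((\<lambda>p. \<bar>f (fst p) - f (snd p)\<bar>) ` {(s, t). \<bar>t - s\<bar> < d})"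
  proof (rule bdd_aboveI2)
    fix p :: "real \<times> real"
    show "\<bar>f (fst p) - f (snd p)\<bar> \<le> 2 * B"
      using B[of "fst p"] B[of "snd p"] by linarith
  qed
  then show ?thesis
    using cSUP_upper[of "(x, y)" "{(s, t). \<bar>t - s\<bar> < d}" "\<lambda>p. \<bar>f (fst p) - f (snd p)\<bar>"] assms(2)
    unfolding osc_def by (simp add: abs_minus_commute)
qed

lemma osc_nonneg: "bounded (range f) \<Longrightarrow> d > 0 \<Longrightarrow> 0 \<le> osc f d"
  using osc_ge[of f 0 0 d] by simp

text \<open>Continuity gives the Borel measurability of \<open>f\<close> on which the integrals of
  clipped integrands rest.\<close>

lemma hoelder_osc_continuous:
  assumes bdd: "bounded (range f)" and \<alpha>: "0 < \<alpha>"
    and hoelder: "\<exists>\<delta>0>0. \<forall>\<delta>. 0 < \<delta> \<and> \<delta> < \<delta>0 \<longrightarrow> osc f \<delta> \<le> C * \<delta> powr \<alpha>"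
  shows "continuous_on UNIV f"
proof -
  obtain \<delta>0 where \<delta>0: "\<delta>0 > 0" "\<And>\<delta>. 0 < \<delta> \<Longrightarrow> \<delta> < \<delta>0 \<Longrightarrow> osc f \<delta> \<le> C * \<delta> powr \<alpha>"
    using hoelder by blast
  have lim: "((\<lambda>\<delta>. C * \<delta> powr \<alpha>) \<longlongrightarrow> 0) (at_right 0)"
    using \<alpha> by real_asymp
  have "\<exists>d>0. \<forall>y. dist y x < d \<longrightarrow> dist (f y) (f x) < e" if e: "e > 0" for x e
  proof -
    have "eventually (\<lambda>\<delta>. C * \<delta> powr \<alpha> < e) (at_right 0)"
      using order_tendstoD(2)[OF lim e] .
    moreover have "eventually (\<lambda>\<delta>. \<delta> \<in> {0<..<\<delta>0}) (at_right (0::real))"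
      using \<delta>0(1) by (rule eventually_at_right_real)
    ultimately have "eventually (\<lambda>\<delta>. C * \<delta> powr \<alpha> < e \<and> \<delta> \<in> {0<..<\<delta>0}) (at_right 0)"
      by (rule eventually_conj)
    from eventually_happens[OF this] obtain d where d: "C * d powr \<alpha> < e" "0 < d" "d < \<delta>0"
      by auto
    have "dist (f y) (f x) < e" if "dist y x < d" for y
      using osc_ge[OF bdd, of y x d] \<delta>0(2)[OF d(2,3)] d(1) that by (simp add: dist_real_def)
    with d(2) show ?thesis by blast
  qed
  then show ?thesis by (simp add: continuous_on_iff)
qed

theorem theorem4:
  fixes M :: "'a measure" and W :: "real \<Rightarrow> 'a \<Rightarrow> real"
    and f :: "real \<Rightarrow> real" and T \<alpha> C :: real
    and Q :: "real \<Rightarrow> real \<Rightarrow> 'a \<Rightarrow> real"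
    and n :: "real \<Rightarrow> nat" and \<gamma> :: "real \<Rightarrow> real"
  assumes BM: "brownian_motion M W"
    and T: "T > 0"
    and f_bdd: "bounded (range f)"
    and \<alpha>: "0 < \<alpha>" "\<alpha> \<le> 1" and C: "C > 0"
    and osc_hoelder: "\<exists>\<delta>0>0. \<forall>\<delta>. 0 < \<delta> \<and> \<delta> < \<delta>0 \<longrightarrow> osc f \<delta> \<le> C * \<delta> powr \<alpha>"
    and Q_qcov: "\<And>\<epsilon> t. \<epsilon> > 0 \<Longrightarrow> t \<in> {0..T} \<Longrightarrow>
        is_qcov M (\<lambda>s \<omega>. f (\<epsilon> * W s \<omega>)) (\<lambda>s \<omega>. \<epsilon> * W s \<omega>) t (Q \<epsilon> t)"
    and Q_cont: "\<And>\<epsilon> \<omega>. \<epsilon> > 0 \<Longrightarrow> \<omega> \<in> space M \<Longrightarrow> continuous_on {0..T} (\<lambda>t. Q \<epsilon> t \<omega>)"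
    and n_pos: "\<And>\<epsilon>. \<epsilon> > 0 \<Longrightarrow> n \<epsilon> > 0"
    and n_mono: "\<And>\<epsilon>1 \<epsilon>2. 0 < \<epsilon>1 \<Longrightarrow> \<epsilon>1 \<le> \<epsilon>2 \<Longrightarrow> n \<epsilon>2 \<le> n \<epsilon>1"
    and n_lim: "filterlim n at_top (at_right 0)"
    and \<gamma>_pos: "\<And>\<epsilon>. \<epsilon> > 0 \<Longrightarrow> \<gamma> \<epsilon> > 0"
    and \<gamma>_lim: "(\<gamma> \<longlongrightarrow> 0) (at_right 0)"
    and cond: "((\<lambda>\<epsilon>. let \<delta> = T / real (n \<epsilon>); q = 2 * sqrt (\<delta> * \<bar>ln \<delta>\<bar>) in
                 \<bar>ln \<delta>\<bar> * osc f (\<epsilon> * q) / (q * \<gamma> \<epsilon>)) \<longlongrightarrow> 0) (at_right 0)"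
  shows "\<exists>K1 K2 K3 \<epsilon>0. K1 > 0 \<and> K2 > 0 \<and> K3 > 0 \<and> \<epsilon>0 > 0 \<and>
    (\<forall>\<epsilon>. 0 < \<epsilon> \<and> \<epsilon> < \<epsilon>0 \<longrightarrow>
      (let \<delta> = T / real (n \<epsilon>); q = 2 * sqrt (\<delta> * \<bar>ln \<delta>\<bar>) in
        measure M {\<omega> \<in> space M. (SUP t\<in>{0..T}. \<bar>Q \<epsilon> t \<omega>\<bar>) / \<epsilon> > \<gamma> \<epsilon>}
          \<le> K1 / \<gamma> \<epsilon> * gauss_tail K3 (\<gamma> \<epsilon>) (osc f (\<epsilon> * q)) + K2 * \<delta>))"
proof -
  define \<delta> where "\<delta> = (\<lambda>\<epsilon>. T / real (n \<epsilon>))"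
  define q where "q = (\<lambda>\<epsilon>. 2 * sqrt (\<delta> \<epsilon> * \<bar>ln (\<delta> \<epsilon>)\<bar>))"
  define X where "X = (\<lambda>\<epsilon>. \<bar>ln (\<delta> \<epsilon>)\<bar> * osc f (\<epsilon> * q \<epsilon>) / (q \<epsilon> * \<gamma> \<epsilon>))"
  define P where "P = (\<lambda>\<epsilon>. measure M {\<omega> \<in> space M. (SUP t\<in>{0..T}. \<bar>Q \<epsilon> t \<omega>\<bar>) / \<epsilon> > \<gamma> \<epsilon>})"
  have "continuous_on UNIV f" by (rule hoelder_osc_continuous[OF f_bdd \<alpha>(1) osc_hoelder])
  then have fm: "f \<in> borel_measurable borel" by (rule borel_measurable_continuous_onI)
  have X: "(X \<longlongrightarrow> 0) (at_right 0)"
    using cond unfolding X_def q_def \<delta>_def Let_def .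
  \<comment> \<open>For \<open>n \<ge> T exp 1\<close> one has
    \<open>\<delta> \<le> exp (- 1)\<close>, so \<open>\<bar>ln \<delta>\<bar> \<ge> 1\<close> and
    \<open>q > 0\<close>.\<close>
  have ev1: "eventually (\<lambda>\<epsilon>. n \<epsilon> \<ge> nat \<lceil>T * exp 1\<rceil>) (at_right 0)"
    using n_lim unfolding filterlim_at_top by blast
  have ev2: "eventually (\<lambda>\<epsilon>. \<gamma> \<epsilon> < 1) (at_right 0)"
    by (rule order_tendstoD(2)[OF \<gamma>_lim]) simp
  \<comment> \<open>544 is the least integer whose square is at least \<open>4 * 16 * 4608\<close>,
    as the premise \<open>16 n \<le> A\<close> of \<open>sup_tail\<close> demands.\<close>
  have ev3: "eventually (\<lambda>\<epsilon>. X \<epsilon> < 1 / (544 * T)) (at_right 0)"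
    by (rule order_tendstoD(2)[OF X]) (use T in simp)
  from eventually_conj[OF ev1 eventually_conj[OF ev2 ev3]]
  obtain \<epsilon>0 where \<epsilon>0: "\<epsilon>0 > 0" and small: "\<And>\<epsilon>. 0 < \<epsilon> \<Longrightarrow> \<epsilon> < \<epsilon>0 \<Longrightarrow>
      n \<epsilon> \<ge> nat \<lceil>T * exp 1\<rceil> \<and> \<gamma> \<epsilon> < 1 \<and> X \<epsilon> < 1 / (544 * T)"
    unfolding eventually_at_right_field by auto
  have main: "P \<epsilon> \<le> 2 / \<gamma> \<epsilon> * gauss_tail (1 / (9216 * T)) (\<gamma> \<epsilon>) (osc f (\<epsilon> * q \<epsilon>)) + 2 * T * \<delta> \<epsilon>"
    if \<epsilon>: "0 < \<epsilon>" "\<epsilon> < \<epsilon>0" for \<epsilon>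
  proof -
    define w where "w = osc f (\<epsilon> * q \<epsilon>)"
    have n0: "real (n \<epsilon>) > 0" using n_pos[OF \<epsilon>(1)] by simp
    have \<delta>0: "\<delta> \<epsilon> > 0" using T n0 by (simp add: \<delta>_def)
    have g: "\<gamma> \<epsilon> > 0" "\<gamma> \<epsilon> < 1" using \<gamma>_pos small \<epsilon> by auto
    have "T * exp 1 \<le> real (n \<epsilon>)"
      using small[OF \<epsilon>] by linarith
    then have "\<delta> \<epsilon> \<le> exp (- 1)"
      using n0 T by (simp add: \<delta>_def exp_minus field_simps)
    then have "ln (\<delta> \<epsilon>) \<le> ln (exp (- 1))"
      using \<delta>0 by (subst ln_le_cancel_iff) auto
    then have l: "ln (\<delta> \<epsilon>) \<le> - 1" by simp
    define L where "L = \<bar>ln (\<delta> \<epsilon>)\<bar>"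
    have L: "L \<ge> 1" "ln (\<delta> \<epsilon>) = - L" using l by (auto simp: L_def)
    have q0: "q \<epsilon> > 0" and q2: "(q \<epsilon>)\<^sup>2 = 4 * (\<delta> \<epsilon> * L)"
      using \<delta>0 L(1) by (auto simp: q_def L_def[symmetric] power_mult_distrib)
    have w0: "w \<ge> 0" unfolding w_def using q0 \<epsilon>(1) by (intro osc_nonneg[OF f_bdd]) simp
    \<comment> \<open>Stated for all \<open>c \<ge> w\<close> because the estimate requires
      \<open>c > 0\<close>: the choice \<open>c = w\<close> settles the case \<open>w > 0\<close>,
      and \<open>c\<close> tends to 0 when \<open>w = 0\<close>.\<close>
    have key: "P \<epsilon> \<le> 2 * exp (- (1 / (9216 * T)) * (\<gamma> \<epsilon>)\<^sup>2 / c\<^sup>2) + 2 * T * \<delta> \<epsilon>"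
      if c: "c > 0" "w \<le> c" "16 * real (n \<epsilon>) \<le> (\<gamma> \<epsilon>)\<^sup>2 / (4608 * T * c\<^sup>2)" for c
    proof -
      interpret B: brownian_qcov M W f T "n \<epsilon>" \<epsilon> c "q \<epsilon>" "Q \<epsilon>"
      proof
        show "\<bar>f x - f y\<bar> \<le> c" if "\<bar>x - y\<bar> < \<epsilon> * q \<epsilon>" for x y
          using osc_ge[OF f_bdd that] c(2) by (simp add: w_def)
      qed (use BM T n_pos \<epsilon> c q0 fm Q_qcov in auto)
      have d: "B.\<delta> = \<delta> \<epsilon>" by (simp add: B.\<delta>_def \<delta>_def)
      have "P \<epsilon> \<le> 2 * exp (- ((\<gamma> \<epsilon>)\<^sup>2 / (4608 * T * c\<^sup>2)) / 2) +
          real (n \<epsilon>) * (2 * exp (- ((q \<epsilon>)\<^sup>2 / (2 * \<delta> \<epsilon>))))"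
        unfolding P_def d[symmetric]
        by (rule B.sup_tail[OF Q_cont[OF \<epsilon>(1)] g(1) refl c(3)])
      also have "- ((\<gamma> \<epsilon>)\<^sup>2 / (4608 * T * c\<^sup>2)) / 2 = - (1 / (9216 * T)) * (\<gamma> \<epsilon>)\<^sup>2 / c\<^sup>2"
        by simp
      also have "- ((q \<epsilon>)\<^sup>2 / (2 * \<delta> \<epsilon>)) = ln (\<delta> \<epsilon>) + ln (\<delta> \<epsilon>)"
        unfolding q2 L(2) using \<delta>0 by simp
      also have "exp (ln (\<delta> \<epsilon>) + ln (\<delta> \<epsilon>)) = \<delta> \<epsilon> * \<delta> \<epsilon>"
        unfolding exp_add using \<delta>0 by simp
      also have "real (n \<epsilon>) * (2 * (\<delta> \<epsilon> * \<delta> \<epsilon>)) = 2 * T * \<delta> \<epsilon>"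
        using n0 by (simp add: \<delta>_def)
      finally show ?thesis .
    qed
    show ?thesis
    proof (cases "w = 0")
      case True
      \<comment> \<open>Here \<open>gauss_tail\<close> is 0, so \<open>2 T \<delta>\<close> alone
        must bound \<open>P \<epsilon>\<close>. As \<open>P \<epsilon>\<close> does not depend on
        \<open>c\<close>, this is the limit of \<open>key\<close>.\<close>
      have "((\<lambda>c. 2 * exp (- (1 / (9216 * T)) * (\<gamma> \<epsilon>)\<^sup>2 / c\<^sup>2) + 2 * T * \<delta> \<epsilon>) \<longlongrightarrow> 2 * 0 + 2 * T * \<delta> \<epsilon>) (at_right 0)"
      proof -
        define u where "u = (1 / (9216 * T)) * (\<gamma> \<epsilon>)\<^sup>2"
        have u: "u > 0" using T g by (simp add: u_def)
        then have "((\<lambda>c. exp (- u / c\<^sup>2)) \<longlongrightarrow> 0) (at_right 0)"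
          by real_asymp
        then show ?thesis
          unfolding u_def mult_minus_left[symmetric] by (intro tendsto_intros)
      qed
      moreover have "eventually (\<lambda>c. P \<epsilon> \<le> 2 * exp (- (1 / (9216 * T)) * (\<gamma> \<epsilon>)\<^sup>2 / c\<^sup>2) + 2 * T * \<delta> \<epsilon>) (at_right 0)"
      proof -
        \<comment> \<open>The largest \<open>c\<close> that the third premise of \<open>key\<close>
          allows.\<close>
        define v where "v = \<gamma> \<epsilon> / sqrt (16 * real (n \<epsilon>) * (4608 * T))"
        have v: "v > 0" using g n0 T by (simp add: v_def)
        have "P \<epsilon> \<le> 2 * exp (- (1 / (9216 * T)) * (\<gamma> \<epsilon>)\<^sup>2 / c\<^sup>2) + 2 * T * \<delta> \<epsilon>" if "0 < c" "c < v" for c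
        proof (rule key)
          have "c\<^sup>2 \<le> v\<^sup>2" using that by (intro power_mono) auto
          also have "v\<^sup>2 = (\<gamma> \<epsilon>)\<^sup>2 / (16 * real (n \<epsilon>) * (4608 * T))"
            using n0 T by (simp add: v_def power_divide)
          finally show "16 * real (n \<epsilon>) \<le> (\<gamma> \<epsilon>)\<^sup>2 / (4608 * T * c\<^sup>2)"
            using n0 T that(1) by (simp add: field_simps)
        qed (use that True in auto)
        with v show ?thesis unfolding eventually_at_right_field by blast
      qed
      ultimately have "P \<epsilon> \<le> 2 * 0 + 2 * T * \<delta> \<epsilon>"
        by (rule tendsto_lowerbound) simp
      then show ?thesis using True by (simp add: gauss_tail_def w_def)
    next
      case False
      then have w: "w > 0" using w0 by simp
      \<comment> \<open>As \<open>q\<^sup>2 = 4 \<delta> L\<close>, squaring leaves one factor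
        \<open>L\<close> in the numerator. It is at least 1 and is dropped below, which gives
        \<open>n w\<^sup>2 \<le> 4 T \<gamma>\<^sup>2 X\<^sup>2\<close>.\<close>
      have X2: "(X \<epsilon>)\<^sup>2 = L * w\<^sup>2 * real (n \<epsilon>) / (4 * T * (\<gamma> \<epsilon>)\<^sup>2)"
      proof -
        have "(X \<epsilon>)\<^sup>2 = (L * w)\<^sup>2 / ((q \<epsilon>)\<^sup>2 * (\<gamma> \<epsilon>)\<^sup>2)"
          by (simp add: X_def L_def w_def power_divide power_mult_distrib)
        also have "\<dots> = L * w\<^sup>2 / (4 * \<delta> \<epsilon> * (\<gamma> \<epsilon>)\<^sup>2)"
          unfolding q2 using L(1) \<delta>0 g by (simp add: power2_eq_square mult_ac)
        finally show ?thesis unfolding \<delta>_def using n0 by simp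
      qed
      have X0: "X \<epsilon> \<ge> 0"
        unfolding X_def using w0 q0 g by (simp add: w_def)
      have "w\<^sup>2 * real (n \<epsilon>) \<le> L * (w\<^sup>2 * real (n \<epsilon>))"
        using L(1) mult_right_mono[of 1 L "w\<^sup>2 * real (n \<epsilon>)"] by simp
      also have "\<dots> = 4 * T * (\<gamma> \<epsilon>)\<^sup>2 * (X \<epsilon>)\<^sup>2"
        unfolding X2 using T g by simp
      also have "\<dots> \<le> 4 * T * (\<gamma> \<epsilon>)\<^sup>2 * (1 / (544 * T))\<^sup>2"
        using small[OF \<epsilon>] X0 T by (intro mult_left_mono power_mono) auto
      also have "\<dots> \<le> (\<gamma> \<epsilon>)\<^sup>2 / (16 * 4608 * T)"
        using T by (simp add: power2_eq_square field_simps)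
      finally have "16 * real (n \<epsilon>) \<le> (\<gamma> \<epsilon>)\<^sup>2 / (4608 * T * w\<^sup>2)"
        using T w by (simp add: field_simps)
      from key[OF w order_refl this]
      have "P \<epsilon> \<le> 2 * gauss_tail (1 / (9216 * T)) (\<gamma> \<epsilon>) w + 2 * T * \<delta> \<epsilon>"
        using False by (simp add: gauss_tail_def)
      \<comment> \<open>\<open>\<gamma> < 1\<close> permits weakening the prefactor 2 to the
        required form \<open>2 / \<gamma>\<close>.\<close>
      also have "2 * gauss_tail (1 / (9216 * T)) (\<gamma> \<epsilon>) w \<le> 2 / \<gamma> \<epsilon> * gauss_tail (1 / (9216 * T)) (\<gamma> \<epsilon>) w"
        using g by (intro mult_right_mono) (auto simp: gauss_tail_def field_simps)
      finally show ?thesis by (simp add: w_def)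
    qed
  qed
  show ?thesis
    using T \<epsilon>0 main
    by (intro exI[of _ 2] exI[of _ "2 * T"] exI[of _ "1 / (9216 * T)"] exI[of _ \<epsilon>0])
       (auto simp: Let_def P_def q_def \<delta>_def)
qed

end
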